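(* For any pseudo-reflection group $G$, $$\mathrm{Hilb}(\mathcal{SR}_G; q, -q) = \sum_{k \geq 0} (-q)^k\, \mathrm{Hilb}(\mathcal{SR}_G^k; q) = 1.$$
   Context: Setting. $K \subset \mathbb{C}$ is a subfield closed under complex conjugation, $V = K^n$. A pseudo-reflection group $G \subset \mathrm{GL}(V)$ is a finite group of unitary matrices generated by pseudo-reflections (non-identity transformations of finite order fixing a hyperplane pointwise). $x_1,\dots,x_n$ are the coordinate functions on $V$. $K[x_1,\dots,x_n,\theta_1,\dots,\theta_n]$ is the $K$-algebra with $x_ix_j=x_jx_i$, $x_i\theta_j=\theta_jx_i$, $\theta_i\theta_j=-\theta_j\theta_i$ (so $\theta_i^2=0$), bigraded by $x$-degree and $\theta$-degree. $G$ acts by $K$-algebra automorphisms with $\sigma\cdot x_j=\sum_i\overline{\sigma_{ij}}x_i$, $\sigma\cdot\theta_j=\sum_i\overline{\sigma_{ij}}\theta_i$. $\mathcal{J}_G$ is the ideal generated by the bi-homogeneous $G$-invariant elements of positive total degree. The super coinvariant algebra is $\mathcal{SR}_G=K[x_1,\dots,x_n,\theta_1,\dots,\theta_n]/\mathcal{J}_G$; $\mathcal{SR}_G^{i,k}$ is its component of $x$-degree $i$ and $\theta$-degree $k$, and $\mathcal{SR}_G^k=\bigoplus_i\mathcal{SR}_G^{i,k}$. The Hilbert series are $$\mathrm{Hilb}(\mathcal{SR}_G^k;q)=\sum_{i\ge0}q^i\dim_K\mathcal{SR}_G^{i,k},\qquad \mathrm{Hilb}(\mathcal{SR}_G;q,z)=\sum_{k\ge0}z^k\,\mathrm{Hilb}(\mathcal{SR}_G^k;q).$$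 *)

theory Defs
  imports
    "HOL-Library.Poly_Mapping"
    "HOL-Computational_Algebra.Formal_Power_Series"
    "HOL-Algebra.QuotRing"
    "HOL-Algebra.Embedded_Algebras"
    "HOL-Algebra.Algebraic_Closure_Type"
    "Jordan_Normal_Form.Matrix"
    "Jordan_Normal_Form.Schur_Decomposition"
begin

section \<open>Pseudo-reflection groups\<close>

definition conj_closed_subfield :: "complex set \<Rightarrow> bool" where
  "conj_closed_subfield K \<longleftrightarrow>
     subfield K (ring_of_type_algebra :: complex ring) \<and> (\<forall>c\<in>K. cnj c \<in> K)"

definition vecs :: "complex set \<Rightarrow> nat \<Rightarrow> complex vec set" where
  "vecs K n = {v \<in> carrier_vec n. \<forall>i<n. v $ i \<in> K}"

definition mats :: "complex set \<Rightarrow> nat \<Rightarrow> complex mat set" where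
  "mats K n = {A \<in> carrier_mat n n. \<forall>i<n. \<forall>j<n. A $$ (i, j) \<in> K}"

definition GL :: "complex set \<Rightarrow> nat \<Rightarrow> complex mat monoid" where
  "GL K n = units_of ((ring_mat TYPE(complex) n ())\<lparr>carrier := mats K n\<rparr>)"

definition unitary_mat :: "nat \<Rightarrow> complex mat \<Rightarrow> bool" where
  "unitary_mat n A \<longleftrightarrow> A \<in> carrier_mat n n \<and>
     A * mat_adjoint A = 1\<^sub>m n \<and> mat_adjoint A * A = 1\<^sub>m n"

text \<open>A linear hyperplane is the kernel of a nonzero linear functional.\<close>

definition hyperplane :: "complex set \<Rightarrow> nat \<Rightarrow> complex vec set \<Rightarrow> bool" where
  "hyperplane K n H \<longleftrightarrow>
     (\<exists>a \<in> vecs K n. a \<noteq> 0\<^sub>v n \<and> H = {v \<in> vecs K n. a \<bullet> v = 0})"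

definition pseudo_reflection :: "complex set \<Rightarrow> nat \<Rightarrow> complex mat \<Rightarrow> bool" where
  "pseudo_reflection K n A \<longleftrightarrow>
     A \<in> carrier (GL K n) \<and> A \<noteq> 1\<^sub>m n \<and> (\<exists>m>0. A ^\<^sub>m m = 1\<^sub>m n) \<and>
     (\<exists>H. hyperplane K n H \<and> (\<forall>v\<in>H. A *\<^sub>v v = v))"

definition pseudo_reflection_group :: "complex set \<Rightarrow> nat \<Rightarrow> complex mat set \<Rightarrow> bool" where
  "pseudo_reflection_group K n G \<longleftrightarrow>
     subgroup G (GL K n) \<and> finite G \<and> (\<forall>A\<in>G. unitary_mat n A) \<and>
     G = generate (GL K n) {A \<in> G. pseudo_reflection K n A}"


section \<open>The superpolynomial ring\<close>

text \<open>
  Elements are represented in the monomial basis: the pair \<open>(a, S)\<close> with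
  \<open>S = {s\<^sub>1 < \<dots> < s\<^sub>k}\<close> stands for
  \<open>(\<Prod>j. x\<^sub>j ^ a\<^sub>j) \<theta>\<^sub>s\<^sub>1 \<dots> \<theta>\<^sub>s\<^sub>k\<close>.
  Variables are indexed by \<open>0, \<dots>, n - 1\<close>.
\<close>

type_synonym super = "((nat \<Rightarrow>\<^sub>0 nat) \<times> nat set) \<Rightarrow>\<^sub>0 complex"

text \<open>
  Sorting the concatenation of the increasing words for \<open>S\<close> and \<open>T\<close> costs one sign per
  inversion.
\<close>

definition theta_sign :: "nat set \<Rightarrow> nat set \<Rightarrow> complex" where
  "theta_sign S T = (- 1) ^ card {(s, t). s \<in> S \<and> t \<in> T \<and> t < s}"

definition super_mult :: "super \<Rightarrow> super \<Rightarrow> super" where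
  "super_mult f g =
     (\<Sum>(a, S)\<in>Poly_Mapping.keys f. \<Sum>(b, T)\<in>Poly_Mapping.keys g.
        if S \<inter> T = {}
        then Poly_Mapping.single (a + b, S \<union> T)
               (theta_sign S T * Poly_Mapping.lookup f (a, S) * Poly_Mapping.lookup g (b, T))
        else 0)"

definition super_const :: "complex \<Rightarrow> super" where
  "super_const c = Poly_Mapping.single (0, {}) c"

definition super_x :: "nat \<Rightarrow> super" where
  "super_x j = Poly_Mapping.single (Poly_Mapping.single j 1, {}) 1"

definition super_theta :: "nat \<Rightarrow> super" where
  "super_theta j = Poly_Mapping.single (0, {j}) 1"

definition super_ring :: "complex set \<Rightarrow> nat \<Rightarrow> super ring" where
  "super_ring K n =
     \<lparr>carrier = {f. \<forall>(a, S) \<in> Poly_Mapping.keys f.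
                   Poly_Mapping.keys a \<subseteq> {..<n} \<and> S \<subseteq> {..<n} \<and> Poly_Mapping.lookup f (a, S) \<in> K},
      monoid.mult = super_mult, one = super_const 1, ring.zero = 0, add = (+)\<rparr>"

definition super_component :: "complex set \<Rightarrow> nat \<Rightarrow> nat \<Rightarrow> nat \<Rightarrow> super set" where
  "super_component K n i k =
     {f \<in> carrier (super_ring K n). \<forall>(a, S) \<in> Poly_Mapping.keys f.
        (\<Sum>j\<in>Poly_Mapping.keys a. Poly_Mapping.lookup a j) = i \<and> card S = k}"


section \<open>The group action and the super coinvariant algebra\<close>

definition act_x :: "nat \<Rightarrow> complex mat \<Rightarrow> nat \<Rightarrow> super" where
  "act_x n \<sigma> j = (\<Sum>i<n. super_mult (super_const (cnj (\<sigma> $$ (i, j)))) (super_x i))"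

definition act_theta :: "nat \<Rightarrow> complex mat \<Rightarrow> nat \<Rightarrow> super" where
  "act_theta n \<sigma> j = (\<Sum>i<n. super_mult (super_const (cnj (\<sigma> $$ (i, j)))) (super_theta i))"

text \<open>
  The algebra endomorphism determined by the images of the generators: every monomial
  \<open>x\<^sub>0 ^ a\<^sub>0 \<dots> x\<^sub>n\<^sub>-\<^sub>1 ^ a\<^sub>n\<^sub>-\<^sub>1 \<theta>\<^sub>s\<^sub>1 \<dots> \<theta>\<^sub>s\<^sub>k\<close>
  is sent to the corresponding ordered product of the images, extended linearly.
\<close>

definition super_act :: "complex set \<Rightarrow> nat \<Rightarrow> complex mat \<Rightarrow> super \<Rightarrow> super" where
  "super_act K n \<sigma> f =
     (let R = super_ring K n;
          product = (\<lambda>us. foldr (\<otimes>\<^bsub>R\<^esub>) us \<one>\<^bsub>R\<^esub>)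
      in \<Sum>(a, S)\<in>Poly_Mapping.keys f.
           super_const (Poly_Mapping.lookup f (a, S))
           \<otimes>\<^bsub>R\<^esub> product (map (\<lambda>j. act_x n \<sigma> j [^]\<^bsub>R\<^esub> Poly_Mapping.lookup a j) [0..<n])
           \<otimes>\<^bsub>R\<^esub> product (map (act_theta n \<sigma>) (sorted_list_of_set S)))"

definition invariant_ideal :: "complex set \<Rightarrow> nat \<Rightarrow> complex mat set \<Rightarrow> super set" where
  "invariant_ideal K n G =
     genideal (super_ring K n)
       {f. \<exists>i k. i + k > 0 \<and> f \<in> super_component K n i k \<and> (\<forall>\<sigma>\<in>G. super_act K n \<sigma> f = f)}"

definition SR :: "complex set \<Rightarrow> nat \<Rightarrow> complex mat set \<Rightarrow> super set ring" where
  "SR K n G = super_ring K n Quot invariant_ideal K n G"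

definition SR_class :: "complex set \<Rightarrow> nat \<Rightarrow> complex mat set \<Rightarrow> super \<Rightarrow> super set" where
  "SR_class K n G f = invariant_ideal K n G +>\<^bsub>super_ring K n\<^esub> f"

definition SR_component ::
    "complex set \<Rightarrow> nat \<Rightarrow> complex mat set \<Rightarrow> nat \<Rightarrow> nat \<Rightarrow> super set set" where
  "SR_component K n G i k = SR_class K n G ` super_component K n i k"

text \<open>
  The dimension is over the copy of \<open>K\<close> embedded in the quotient as constants.
\<close>

definition SR_dim :: "complex set \<Rightarrow> nat \<Rightarrow> complex mat set \<Rightarrow> nat \<Rightarrow> nat \<Rightarrow> nat" where
  "SR_dim K n G i k =
     ring.dim (SR K n G) ((SR_class K n G \<circ> super_const) ` K) (SR_component K n G i k)"


section \<open>Hilbert series\<close>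

definition Hilb_theta_degree :: "complex set \<Rightarrow> nat \<Rightarrow> complex mat set \<Rightarrow> nat \<Rightarrow> int fps" where
  "Hilb_theta_degree K n G k = Abs_fps (\<lambda>i. int (SR_dim K n G i k))"

text \<open>
  The two-variable series is a power series in \<open>z\<close> whose coefficients are power series in \<open>q\<close>.
\<close>

definition Hilb :: "complex set \<Rightarrow> nat \<Rightarrow> complex mat set \<Rightarrow> int fps fps" where
  "Hilb K n G = Abs_fps (Hilb_theta_degree K n G)"

definition specialize_z :: "int fps fps \<Rightarrow> int fps \<Rightarrow> int fps" where
  "specialize_z F u = suminf (\<lambda>k. u ^ k * fps_nth F k)"

end

theory Submission
  imports Defs
begin

text \<open>
  A class of \<open>x\<close>-degree \<open>i\<close> and \<open>\<theta>\<close>-degree \<open>k\<close> contributes \<open>(- 1) ^ k\<close> to the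
  coefficient of \<open>q ^ (i + k)\<close> in the specialised series.  The coefficient of \<open>q ^ m\<close> is
  therefore the Euler characteristic of the strand of total degree \<open>m\<close> of the super coinvariant
  algebra, and the claim is that this strand is acyclic for \<open>m > 0\<close>.

  Two odd operators move along the strand.  The exterior derivative
  \<open>derham = (\<Sum>i. \<theta>\<^sub>i \<partial>/\<partial>x\<^sub>i)\<close> trades an \<open>x\<close> for a \<open>\<theta>\<close>, and the Koszul differential
  \<open>koszul = (\<Sum>i. x\<^sub>i \<partial>/\<partial>\<theta>\<^sub>i)\<close> trades a \<open>\<theta>\<close> for an \<open>x\<close>.  Both square to zero, and
  \<open>derham koszul + koszul derham\<close> multiplies an element by its total degree (\<open>euler\<close>), which is
  invertible in characteristic zero as soon as it is positive.

  All of this descends to the quotient.  The group acts on the \<open>x\<^sub>j\<close> and on the \<open>\<theta>\<^sub>j\<close> by the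
  same matrices, so both operators commute with it (\<open>act_derham\<close>, \<open>act_koszul\<close>) and send
  bihomogeneous invariants to bihomogeneous invariants of the same total degree.  Both are graded
  derivations (\<open>derham_mult\<close>, \<open>koszul_mult\<close>), so they preserve the ideal that the invariants of
  positive degree generate (\<open>J_stable\<close>).  Hence each strand of positive total degree is a
  contractible complex of finite-dimensional spaces, and its Euler characteristic vanishes
  (\<open>contractible_complex_euler_characteristic\<close>, \<open>total_degree_euler_characteristic\<close>).  In total
  degree zero only the constants remain, and they survive because the ideal is proper
  (\<open>J_proper\<close>); they account for the value \<open>1\<close>.

  The identities between operators are all obtained by one induction (\<open>generator_induct\<close>): every
  superpolynomial arises from constants by additions and by left multiplications with generators,
  so an operator is controlled by its commutation rules with the \<open>x\<^sub>j\<close> and the \<open>\<theta>\<^sub>j\<close>.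
\<close>

section \<open>Additive maps and multiplication of superpolynomials\<close>

notation super_mult (infixl \<open>\<star>\<close> 70)

abbreviation smono :: "(nat \<Rightarrow>\<^sub>0 nat) \<Rightarrow> nat set \<Rightarrow> complex \<Rightarrow> super" where
  "smono a S c \<equiv> Poly_Mapping.single (a, S) c"

text \<open>
  Since a coefficient can be absorbed into its monomial, additive maps that agree on the terms of
  \<open>f\<close> agree at \<open>f\<close>.  This reduces every identity below to single terms without any separate
  treatment of scalars.
\<close>

definition additive_map :: "(super \<Rightarrow> super) \<Rightarrow> bool" where
  "additive_map F \<longleftrightarrow> (\<forall>f g. F (f + g) = F f + F g)"

lemma additive_map_add: "additive_map F \<Longrightarrow> F (f + g) = F f + F g"
  by (simp add: additive_map_def)

lemma additive_map_zero: "additive_map F \<Longrightarrow> F 0 = 0"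
  by (metis additive_map_def add_cancel_right_right)

lemma additive_map_minus: "additive_map F \<Longrightarrow> F (- f) = - F f"
  using additive_map_add[of F "- f" f] additive_map_zero[of F] by (simp add: eq_neg_iff_add_eq_0)

lemma additive_map_diff: "additive_map F \<Longrightarrow> F (f - g) = F f - F g"
  by (metis additive_map_add additive_map_minus diff_conv_add_uminus)

lemma additive_map_sum: "additive_map F \<Longrightarrow> F (sum h A) = (\<Sum>i\<in>A. F (h i))"
  by (induction A rule: infinite_finite_induct) (simp_all add: additive_map_zero additive_map_add)

text \<open>
  The additive extension of a map on terms.  The coefficient is an argument of \<open>\<phi>\<close>, so that
  multiplication, the differential operators and the group action are all instances.
\<close>

definition termwise :: "((nat \<Rightarrow>\<^sub>0 nat) \<Rightarrow> nat set \<Rightarrow> complex \<Rightarrow> super) \<Rightarrow> super \<Rightarrow> super" where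
  "termwise \<phi> f = (\<Sum>(a, S)\<in>Poly_Mapping.keys f. \<phi> a S (Poly_Mapping.lookup f (a, S)))"

lemma additive_map_termwise:
  assumes "\<And>a S. \<phi> a S 0 = 0" "\<And>a S c d. \<phi> a S (c + d) = \<phi> a S c + \<phi> a S d"
  shows "additive_map (termwise \<phi>)"
  unfolding additive_map_def termwise_def
proof (intro allI)
  fix f g :: super
  show "(\<Sum>(a, S)\<in>Poly_Mapping.keys (f + g). \<phi> a S (Poly_Mapping.lookup (f + g) (a, S))) =
    (\<Sum>(a, S)\<in>Poly_Mapping.keys f. \<phi> a S (Poly_Mapping.lookup f (a, S))) +
    (\<Sum>(a, S)\<in>Poly_Mapping.keys g. \<phi> a S (Poly_Mapping.lookup g (a, S)))"
    using setsum_keys_plus_distrib[of "\<lambda>(a, S). \<phi> a S" f g]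
    by (simp add: assms case_prod_beta)
qed

lemma termwise_single:
  assumes "\<And>a S. \<phi> a S 0 = 0"
  shows "termwise \<phi> (smono a S c) = \<phi> a S c"
  using assms by (cases "c = 0") (simp_all add: termwise_def)

lemma super_induct [case_names zero add single]:
  assumes "P 0" "\<And>f g. P f \<Longrightarrow> P g \<Longrightarrow> P (f + g)"
    and "\<And>a S. (a, S) \<in> Poly_Mapping.keys f \<Longrightarrow> P (smono a S (Poly_Mapping.lookup f (a, S)))"
  shows "P f"
proof -
  have "P (\<Sum>p\<in>A. Poly_Mapping.single p (Poly_Mapping.lookup f p))"
    if "finite A" "A \<subseteq> Poly_Mapping.keys f" for A
    using that assms by (induction A) auto
  then have *: "P (\<Sum>p\<in>Poly_Mapping.keys f. Poly_Mapping.single p (Poly_Mapping.lookup f p))"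
    by simp
  have "f = (\<Sum>p\<in>Poly_Mapping.keys f. Poly_Mapping.single p (Poly_Mapping.lookup f p))"
    by (rule poly_mapping_eqI) (auto simp: lookup_sum lookup_single when_def in_keys_iff)
  then show ?thesis
    by (rule ssubst) (rule *)
qed

lemma additive_map_eqI:
  assumes "additive_map F" "additive_map G"
    and "\<And>a S. (a, S) \<in> Poly_Mapping.keys f \<Longrightarrow> F (smono a S (Poly_Mapping.lookup f (a, S))) = G (smono a S (Poly_Mapping.lookup f (a, S)))"
  shows "F f = G f"
  by (induction f rule: super_induct) (use assms in \<open>simp_all add: additive_map_zero additive_map_add\<close>)

lemma additive_map_comp: "additive_map F \<Longrightarrow> additive_map G \<Longrightarrow> additive_map (\<lambda>f. F (G f))"
  by (simp add: additive_map_def)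

lemma additive_map_plus: "additive_map F \<Longrightarrow> additive_map G \<Longrightarrow> additive_map (\<lambda>f. F f + G f)"
  by (simp add: additive_map_def)

lemma additive_map_uminus: "additive_map F \<Longrightarrow> additive_map (\<lambda>f. - F f)"
  by (simp add: additive_map_def)

lemma additive_map_sum_of_maps: "(\<And>i. additive_map (F i)) \<Longrightarrow> additive_map (\<lambda>f. \<Sum>i\<in>A. F i f)"
  by (simp add: additive_map_def sum.distrib)

lemma super_mult_as_termwise:
  "f \<star> g = termwise (\<lambda>a S c. termwise (\<lambda>b T d. if S \<inter> T = {}
     then smono (a + b) (S \<union> T) (theta_sign S T * c * d) else 0) g) f"
  by (simp add: super_mult_def termwise_def)

lemma termwise_zero: "(\<And>a S c. \<phi> a S c = 0) \<Longrightarrow> termwise \<phi> f = 0"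
  by (simp add: termwise_def case_prod_beta)

lemma termwise_add_fun: "termwise (\<lambda>a S c. \<phi> a S c + \<psi> a S c) f = termwise \<phi> f + termwise \<psi> f"
  by (simp add: termwise_def case_prod_beta sum.distrib)

lemma additive_super_mult_left: "additive_map (\<lambda>f. f \<star> g)"
  unfolding super_mult_as_termwise
  by (rule additive_map_termwise)
     (auto intro!: termwise_zero arg_cong2[where f = termwise]
       simp: termwise_add_fun[symmetric] single_add[symmetric] fun_eq_iff algebra_simps)

lemma additive_super_mult_right: "additive_map (\<lambda>g. f \<star> g)"
proof -
  have "additive_map (termwise (\<lambda>b T d. if S \<inter> T = {}
     then smono (a + b) (S \<union> T) (theta_sign S T * c * d) else 0))" for a S c
    by (rule additive_map_termwise) (auto simp: single_add[symmetric] algebra_simps)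
  then show ?thesis
    unfolding super_mult_as_termwise additive_map_def by (simp add: termwise_add_fun)
qed

lemmas super_mult_simps =
  additive_map_add[OF additive_super_mult_left] additive_map_add[OF additive_super_mult_right]
  additive_map_zero[OF additive_super_mult_left] additive_map_zero[OF additive_super_mult_right]
  additive_map_minus[OF additive_super_mult_left] additive_map_minus[OF additive_super_mult_right]
  additive_map_diff[OF additive_super_mult_left] additive_map_diff[OF additive_super_mult_right]

lemma smono_mult_smono:
  "smono a S c \<star> smono b T d =
     (if S \<inter> T = {} then smono (a + b) (S \<union> T) (theta_sign S T * c * d) else 0)"
  unfolding super_mult_as_termwise
  by (subst termwise_single, simp add: termwise_zero, subst termwise_single) auto

lemma theta_sign_empty [simp]: "theta_sign {} T = 1" "theta_sign S {} = 1"
  by (simp_all add: theta_sign_def)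

lemma theta_sign_square: "theta_sign S T * theta_sign S T = 1"
  by (simp add: theta_sign_def flip: power_add mult_2)

text \<open>
  Together with its mirror image this is the cocycle identity for \<open>theta_sign\<close>, which is what
  associativity of the multiplication amounts to.
\<close>

lemma theta_sign_Un_left:
  assumes "finite S" "finite S'" "finite T" "S \<inter> S' = {}"
  shows "theta_sign (S \<union> S') T = theta_sign S T * theta_sign S' T"
proof -
  have "{(s, t). s \<in> S \<union> S' \<and> t \<in> T \<and> t < s} =
     {(s, t). s \<in> S \<and> t \<in> T \<and> t < s} \<union> {(s, t). s \<in> S' \<and> t \<in> T \<and> t < s}" by auto
  moreover have "finite {(s, t). s \<in> S \<and> t \<in> T \<and> t < s}"
    by (rule finite_subset[of _ "S \<times> T"]) (use assms in auto)
  moreover have "finite {(s, t). s \<in> S' \<and> t \<in> T \<and> t < s}"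
    by (rule finite_subset[of _ "S' \<times> T"]) (use assms in auto)
  moreover have "{(s, t). s \<in> S \<and> t \<in> T \<and> t < s} \<inter> {(s, t). s \<in> S' \<and> t \<in> T \<and> t < s} = {}"
    using assms(4) by auto
  ultimately show ?thesis
    by (simp add: theta_sign_def card_Un_disjoint power_add)
qed

lemma theta_sign_Un_right:
  assumes "finite S" "finite T" "finite T'" "T \<inter> T' = {}"
  shows "theta_sign S (T \<union> T') = theta_sign S T * theta_sign S T'"
proof -
  have "{(s, t). s \<in> S \<and> t \<in> T \<union> T' \<and> t < s} =
     {(s, t). s \<in> S \<and> t \<in> T \<and> t < s} \<union> {(s, t). s \<in> S \<and> t \<in> T' \<and> t < s}" by auto
  moreover have "finite {(s, t). s \<in> S \<and> t \<in> T \<and> t < s}"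
    by (rule finite_subset[of _ "S \<times> T"]) (use assms in auto)
  moreover have "finite {(s, t). s \<in> S \<and> t \<in> T' \<and> t < s}"
    by (rule finite_subset[of _ "S \<times> T'"]) (use assms in auto)
  moreover have "{(s, t). s \<in> S \<and> t \<in> T \<and> t < s} \<inter> {(s, t). s \<in> S \<and> t \<in> T' \<and> t < s} = {}"
    using assms(4) by auto
  ultimately show ?thesis
    by (simp add: theta_sign_def card_Un_disjoint power_add)
qed

text \<open>
  The sign counts inversions with \<open>card\<close>, which is \<open>0\<close> on infinite sets.  Multiplicativity of the
  sign, and with it associativity, is therefore restricted to finite sets of \<open>\<theta>\<close>-indices.
\<close>

definition finitary :: "super \<Rightarrow> bool" where
  "finitary f \<longleftrightarrow> (\<forall>(a, S)\<in>Poly_Mapping.keys f. finite S)"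

lemma smono_mult_assoc:
  assumes "finite S" "finite T" "finite U"
  shows "(smono a S c \<star> smono b T d) \<star> smono e U k = smono a S c \<star> (smono b T d \<star> smono e U k)"
proof (cases "S \<inter> T = {} \<and> S \<inter> U = {} \<and> T \<inter> U = {}")
  case True
  then have "(S \<union> T) \<inter> U = {}" "S \<inter> (T \<union> U) = {}" by auto
  with True show ?thesis
    by (simp add: smono_mult_smono theta_sign_Un_left theta_sign_Un_right assms ac_simps)
next
  case False
  then have "\<not> (S \<inter> T = {} \<and> (S \<union> T) \<inter> U = {})" "\<not> (T \<inter> U = {} \<and> S \<inter> (T \<union> U) = {})" by auto
  then show ?thesis
    by (auto simp: smono_mult_smono super_mult_simps)
qed

lemma super_mult_assoc:
  assumes "finitary f" "finitary g" "finitary h"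
  shows "(f \<star> g) \<star> h = f \<star> (g \<star> h)"
proof (rule additive_map_eqI[where F = "\<lambda>f. (f \<star> g) \<star> h" and G = "\<lambda>f. f \<star> (g \<star> h)"])
  fix a S assume S: "(a, S) \<in> Poly_Mapping.keys f"
  let ?p = "smono a S (Poly_Mapping.lookup f (a, S))"
  show "(?p \<star> g) \<star> h = ?p \<star> (g \<star> h)"
  proof (rule additive_map_eqI[where F = "\<lambda>g. (?p \<star> g) \<star> h" and G = "\<lambda>g. ?p \<star> (g \<star> h)"])
    fix b T assume T: "(b, T) \<in> Poly_Mapping.keys g"
    let ?q = "smono b T (Poly_Mapping.lookup g (b, T))"
    show "(?p \<star> ?q) \<star> h = ?p \<star> (?q \<star> h)"
      by (rule additive_map_eqI[where F = "\<lambda>h. (?p \<star> ?q) \<star> h" and G = "\<lambda>h. ?p \<star> (?q \<star> h)"])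
        (use S T assms in \<open>auto intro!: additive_map_comp[OF additive_super_mult_right]
          additive_super_mult_right smono_mult_assoc simp: finitary_def\<close>)
  qed (auto intro!: additive_map_comp[OF additive_super_mult_left] additive_map_comp[OF additive_super_mult_right]
         additive_super_mult_left additive_super_mult_right)
qed (auto intro!: additive_map_comp[OF additive_super_mult_left]
       additive_super_mult_left)

section \<open>Generators and the induction over them\<close>

definition xdeg :: "(nat \<Rightarrow>\<^sub>0 nat) \<Rightarrow> nat" where
  "xdeg a = (\<Sum>j\<in>Poly_Mapping.keys a. Poly_Mapping.lookup a j)"

lemma xdeg_zero [simp]: "xdeg 0 = 0"
  by (simp add: xdeg_def)

lemma xdeg_single [simp]: "xdeg (Poly_Mapping.single j m) = m"
  by (simp add: xdeg_def)

lemma xdeg_add: "xdeg (a + b) = xdeg a + xdeg b"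
  unfolding xdeg_def by (rule setsum_keys_plus_distrib) auto

lemma xdeg_eq_0_iff: "xdeg a = 0 \<longleftrightarrow> a = 0"
  by (auto simp: xdeg_def poly_mapping_eq_iff in_keys_iff fun_eq_iff)

lemma exponent_split:
  fixes a :: "nat \<Rightarrow>\<^sub>0 nat"
  assumes "Poly_Mapping.lookup a i > 0"
  shows "a = Poly_Mapping.single i 1 + (a - Poly_Mapping.single i 1)"
  by (rule poly_mapping_eqI) (use assms in \<open>auto simp: lookup_add lookup_minus lookup_single when_def\<close>)

lemma keys_diff_nat: "Poly_Mapping.keys (a - b) \<subseteq> Poly_Mapping.keys (a :: nat \<Rightarrow>\<^sub>0 nat)"
  by (auto simp: in_keys_iff lookup_minus)

lemma theta_sign_less:
  assumes "\<forall>t\<in>S. j < t"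
  shows "theta_sign {j} S = 1"
proof -
  have "{(s, t). s \<in> {j} \<and> t \<in> S \<and> t < s} = {}" using assms by fastforce
  then show ?thesis unfolding theta_sign_def by (simp only:) simp
qed

lemma x_mult_smono: "super_x j \<star> smono a S c = smono (Poly_Mapping.single j 1 + a) S c"
  by (simp add: super_x_def smono_mult_smono)

lemma theta_mult_smono:
  "super_theta j \<star> smono a S c =
     (if j \<in> S then 0 else smono a (insert j S) (theta_sign {j} S * c))"
  by (simp add: super_theta_def smono_mult_smono)

lemma const_mult_smono: "super_const k \<star> smono a S c = smono a S (k * c)"
  by (simp add: super_const_def smono_mult_smono)

lemma smono_mult_const: "smono a S c \<star> super_const k = smono a S (k * c)"
  by (simp add: super_const_def smono_mult_smono mult.commute)

lemma super_const_central: "super_const k \<star> f = f \<star> super_const k"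
  by (rule additive_map_eqI) (auto simp: const_mult_smono smono_mult_const additive_super_mult_left additive_super_mult_right)

lemma super_const_one_mult [simp]: "super_const 1 \<star> f = f"
  by (rule additive_map_eqI[where G = "\<lambda>f. f"])
    (simp_all add: const_mult_smono additive_super_mult_right, simp add: additive_map_def)

lemma super_mult_one [simp]: "f \<star> super_const 1 = f"
  by (simp flip: super_const_central)

lemma super_const_zero [simp]: "super_const 0 = 0"
  by (simp add: super_const_def)

lemma super_const_add: "super_const (c + d) = super_const c + super_const d"
  by (simp add: super_const_def single_add)

lemma super_const_mult: "super_const c \<star> super_const d = super_const (c * d)"
  by (simp add: super_const_def smono_mult_smono)

lemma super_const_uminus_mult: "super_const (- c) \<star> f = - (super_const c \<star> f)"
  by (simp add: super_const_def single_uminus super_mult_simps)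

locale coefficient_field =
  fixes K :: "complex set" and n :: nat
  assumes K_subfield: "subfield K (ring_of_type_algebra :: complex ring)"
begin

lemma K0: "0 \<in> K" and K1: "1 \<in> K"
  and Kadd: "c \<in> K \<Longrightarrow> d \<in> K \<Longrightarrow> c + d \<in> K"
  and Kmult: "c \<in> K \<Longrightarrow> d \<in> K \<Longrightarrow> c * d \<in> K"
  using subringE(2,3,6,7)[OF subfieldE(1)[OF K_subfield]] by (simp_all add: ring_of_type_algebra_def)

lemma Kminus:
  assumes "c \<in> K" shows "- c \<in> K"
proof -
  interpret complex: ring "ring_of_type_algebra :: complex ring" ..
  have "\<ominus>\<^bsub>ring_of_type_algebra\<^esub> c = - c"
    by (rule complex.minus_equality) (simp_all add: ring_of_type_algebra_def)
  then show ?thesis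
    using subringE(5)[OF subfieldE(1)[OF K_subfield] assms] by simp
qed
abbreviation C :: "super set" where "C \<equiv> carrier (super_ring K n)"

lemma K_of_nat: "of_nat m \<in> K"
  by (induction m) (auto simp: K0 K1 Kadd)

lemma K_power_minus_one: "(- 1) ^ m \<in> K"
  by (induction m) (use K1 Kmult Kminus in auto)

lemma K_sign: "theta_sign S T \<in> K"
  unfolding theta_sign_def by (rule K_power_minus_one)

lemma C_iff: "f \<in> C \<longleftrightarrow> (\<forall>(a, S)\<in>Poly_Mapping.keys f.
    Poly_Mapping.keys a \<subseteq> {..<n} \<and> S \<subseteq> {..<n} \<and> Poly_Mapping.lookup f (a, S) \<in> K)"
  by (simp add: super_ring_def)

lemma C_keysD:
  assumes "f \<in> C" "(a, S) \<in> Poly_Mapping.keys f"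
  shows "Poly_Mapping.keys a \<subseteq> {..<n}" "S \<subseteq> {..<n}" "finite S" "Poly_Mapping.lookup f (a, S) \<in> K"
  using assms finite_subset[of S "{..<n}"] unfolding C_iff by auto

lemma C_lookup: "f \<in> C \<Longrightarrow> Poly_Mapping.lookup f p \<in> K"
  using K0 by (cases p; cases "p \<in> Poly_Mapping.keys f") (auto dest: C_keysD simp: in_keys_iff)

lemma C_zero: "0 \<in> C"
  by (simp add: C_iff)

lemma C_single:
  "Poly_Mapping.keys a \<subseteq> {..<n} \<Longrightarrow> S \<subseteq> {..<n} \<Longrightarrow> c \<in> K \<Longrightarrow> smono a S c \<in> C"
  by (simp add: C_iff)

lemma C_add:
  assumes "f \<in> C" "g \<in> C" shows "f + g \<in> C"
  unfolding C_iff
proof safe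
  fix a S assume "(a, S) \<in> Poly_Mapping.keys (f + g)"
  then have "(a, S) \<in> Poly_Mapping.keys f \<or> (a, S) \<in> Poly_Mapping.keys g"
    using Poly_Mapping.keys_add[of f g] by auto
  then have "Poly_Mapping.keys a \<subseteq> {..<n}" "S \<subseteq> {..<n}"
    using assms C_keysD by blast+
  then show "x \<in> Poly_Mapping.keys a \<Longrightarrow> x < n" "x \<in> S \<Longrightarrow> x < n" for x by auto
  show "Poly_Mapping.lookup (f + g) (a, S) \<in> K"
    using assms by (simp add: lookup_add Kadd C_lookup)
qed

lemma C_sum: "(\<And>i. i \<in> A \<Longrightarrow> f i \<in> C) \<Longrightarrow> sum f A \<in> C"
  by (induction A rule: infinite_finite_induct) (auto simp: C_zero C_add)

lemma C_uminus: "f \<in> C \<Longrightarrow> - f \<in> C"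
  by (auto simp: C_iff Kminus)

lemma C_induct [consumes 1, case_names zero add single]:
  assumes "f \<in> C" "P 0"
    and "\<And>f g. f \<in> C \<Longrightarrow> g \<in> C \<Longrightarrow> P f \<Longrightarrow> P g \<Longrightarrow> P (f + g)"
    and "\<And>a S c. Poly_Mapping.keys a \<subseteq> {..<n} \<Longrightarrow> S \<subseteq> {..<n} \<Longrightarrow> c \<in> K \<Longrightarrow> P (smono a S c)"
  shows "P f"
proof -
  have "f \<in> C \<and> P f"
  proof (rule super_induct[where f = f])
    fix a S assume "(a, S) \<in> Poly_Mapping.keys f"
    then show "smono a S (Poly_Mapping.lookup f (a, S)) \<in> C \<and> P (smono a S (Poly_Mapping.lookup f (a, S)))"
      using C_keysD[OF assms(1)] assms(4) C_single by simp
  qed (use assms(2,3) C_zero C_add in auto)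
  then show ?thesis ..
qed

lemma C_finitary: "f \<in> C \<Longrightarrow> finitary f"
  using C_keysD by (fastforce simp: finitary_def)

lemma C_assoc: "f \<in> C \<Longrightarrow> g \<in> C \<Longrightarrow> h \<in> C \<Longrightarrow> (f \<star> g) \<star> h = f \<star> (g \<star> h)"
  by (rule super_mult_assoc) (rule C_finitary; assumption)+

lemma C_mult:
  assumes "f \<in> C" "g \<in> C" shows "f \<star> g \<in> C"
  using assms(1)
proof (induction rule: C_induct)
  case (single a S c)
  from assms(2) show ?case
  proof (induction rule: C_induct)
    case (single b T d)
    show ?case
      unfolding smono_mult_smono
      using single \<open>Poly_Mapping.keys a \<subseteq> {..<n}\<close> \<open>S \<subseteq> {..<n}\<close> \<open>c \<in> K\<close> Poly_Mapping.keys_add[of a b]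
      by (auto simp: C_zero intro!: C_single Kmult K_sign)
  qed (simp_all add: super_mult_simps C_zero C_add)
qed (simp_all add: super_mult_simps C_zero C_add)

lemma C_x: "j < n \<Longrightarrow> super_x j \<in> C"
  unfolding super_x_def by (rule C_single) (auto simp: K1)

lemma C_theta: "j < n \<Longrightarrow> super_theta j \<in> C"
  unfolding super_theta_def by (rule C_single) (auto simp: K1)

lemma C_const: "c \<in> K \<Longrightarrow> super_const c \<in> C"
  unfolding super_const_def by (rule C_single) auto

text \<open>
  A monomial is assembled by putting a variable in front.  Taking the \<open>\<theta>\<close>-factors in decreasing
  order, each new index is smaller than all present ones, and so no sign is produced.
\<close>

lemma smono_induct [consumes 2, case_names const x theta]:
  fixes a :: "nat \<Rightarrow>\<^sub>0 nat"
  assumes "Poly_Mapping.keys a \<subseteq> {..<n}" "S \<subseteq> {..<n}"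
    and const: "P 0 {}"
    and x: "\<And>j a S. j < n \<Longrightarrow> Poly_Mapping.keys a \<subseteq> {..<n} \<Longrightarrow> S \<subseteq> {..<n} \<Longrightarrow> P a S \<Longrightarrow>
              P (Poly_Mapping.single j 1 + a) S"
    and theta: "\<And>j a S. j < n \<Longrightarrow> Poly_Mapping.keys a \<subseteq> {..<n} \<Longrightarrow> S \<subseteq> {..<n} \<Longrightarrow>
              (\<forall>s\<in>S. j < s) \<Longrightarrow> P a S \<Longrightarrow> P a (insert j S)"
  shows "P a S"
  using assms(1)
proof (induction "xdeg a" arbitrary: a)
  case 0
  then have [simp]: "a = 0" by (simp add: xdeg_eq_0_iff)
  have "finite S" using assms(2) finite_subset by blast
  then show ?case
    using assms(2)
  proof (induction "card S" arbitrary: S)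
    case 0
    then show ?case using const by simp
  next
    case (Suc m)
    then have ne: "S \<noteq> {}" by auto
    define j where "j = Min S"
    have j: "j \<in> S" "\<forall>s\<in>S - {j}. j < s"
      using ne Suc.prems by (auto simp: j_def order.strict_iff_order)
    have "P a (S - {j})"
      using Suc.prems Suc.hyps(2) j by (intro Suc.hyps(1)) auto
    with theta[of j a "S - {j}"] j Suc.prems show ?case
      by (auto simp: insert_absorb)
  qed
next
  case (Suc m)
  then obtain j where j: "j \<in> Poly_Mapping.keys a"
    by (metis keys_eq_empty xdeg_zero all_not_in_conv Zero_not_Suc)
  let ?b = "a - Poly_Mapping.single j 1"
  have split: "a = Poly_Mapping.single j 1 + ?b"
    using j by (intro exponent_split) (auto simp: in_keys_iff)
  have "xdeg a = Suc (xdeg ?b)"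
    by (subst split) (simp add: xdeg_add)
  moreover have "Poly_Mapping.keys ?b \<subseteq> {..<n}"
    using keys_diff_nat Suc.prems by blast
  ultimately have "P (Poly_Mapping.single j 1 + ?b) S"
    using Suc j by (intro x) (auto simp: assms)
  with split show ?case by simp
qed

text \<open>
  Left multiplications by generators build every element from constants.  An identity between
  operators thus only has to be carried through one multiplication by \<open>x\<^sub>j\<close> or \<open>\<theta>\<^sub>j\<close>.
\<close>

lemma generator_induct [consumes 1, case_names const add x theta]:
  assumes "f \<in> C"
    and const: "\<And>c. c \<in> K \<Longrightarrow> P (super_const c)"
    and add: "\<And>f g. f \<in> C \<Longrightarrow> g \<in> C \<Longrightarrow> P f \<Longrightarrow> P g \<Longrightarrow> P (f + g)"
    and x: "\<And>j f. j < n \<Longrightarrow> f \<in> C \<Longrightarrow> P f \<Longrightarrow> P (super_x j \<star> f)"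
    and theta: "\<And>j f. j < n \<Longrightarrow> f \<in> C \<Longrightarrow> P f \<Longrightarrow> P (super_theta j \<star> f)"
  shows "P f"
  using assms(1)
proof (induction rule: C_induct)
  case zero
  show ?case using const[OF K0] by simp
next
  case (single a S c)
  then show ?case
  proof (induction rule: smono_induct)
    case const
    show ?case using assms(2)[OF \<open>c \<in> K\<close>] by (simp add: super_const_def)
  next
    case (x j a S)
    then have "P (super_x j \<star> smono a S c)"
      using single by (intro assms(4) C_single) auto
    then show ?case by (simp add: x_mult_smono)
  next
    case (theta j a S)
    then have "P (super_theta j \<star> smono a S c)"
      using single by (intro assms(5) C_single) auto
    moreover have "theta_sign {j} S = 1"
      using theta by (intro theta_sign_less) auto
    moreover have "j \<notin> S" using theta by auto
    ultimately show ?case by (simp add: theta_mult_smono)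
  qed
qed (rule add)

end

section \<open>Exterior derivative and Koszul differential\<close>

definition partial_x :: "nat \<Rightarrow> super \<Rightarrow> super" where
  "partial_x i = termwise (\<lambda>a S c. smono (a - Poly_Mapping.single i 1) S (of_nat (Poly_Mapping.lookup a i) * c))"

definition partial_theta :: "nat \<Rightarrow> super \<Rightarrow> super" where
  "partial_theta i = termwise (\<lambda>a S c. if i \<in> S then smono a (S - {i}) (theta_sign {i} S * c) else 0)"

text \<open>
  The automorphism \<open>\<theta>\<^sub>j \<mapsto> - \<theta>\<^sub>j\<close>; it carries the sign in the graded Leibniz rules.
\<close>

definition parity :: "super \<Rightarrow> super" where
  "parity = termwise (\<lambda>a S c. smono a S ((- 1) ^ card S * c))"

definition derham :: "nat \<Rightarrow> super \<Rightarrow> super" where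
  "derham n f = (\<Sum>i<n. super_theta i \<star> partial_x i f)"

definition koszul :: "nat \<Rightarrow> super \<Rightarrow> super" where
  "koszul n f = (\<Sum>i<n. super_x i \<star> partial_theta i f)"

lemma additive_partial_x: "additive_map (partial_x i)"
  unfolding partial_x_def by (rule additive_map_termwise) (simp_all add: single_add algebra_simps)

lemma additive_partial_theta: "additive_map (partial_theta i)"
  unfolding partial_theta_def by (rule additive_map_termwise) (simp_all add: single_add algebra_simps)

lemma additive_parity: "additive_map parity"
  unfolding parity_def by (rule additive_map_termwise) (simp_all add: single_add algebra_simps)

lemma partial_x_smono: "partial_x i (smono a S c) = smono (a - Poly_Mapping.single i 1) S (of_nat (Poly_Mapping.lookup a i) * c)"
  by (simp add: partial_x_def termwise_single)

lemma partial_theta_smono: "partial_theta i (smono a S c) = (if i \<in> S then smono a (S - {i}) (theta_sign {i} S * c) else 0)"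
  by (simp add: partial_theta_def termwise_single)

lemma parity_smono: "parity (smono a S c) = smono a S ((- 1) ^ card S * c)"
  by (simp add: parity_def termwise_single)

lemma additive_derham: "additive_map (derham n)"
  using additive_map_sum_of_maps[OF additive_map_comp[OF additive_super_mult_right additive_partial_x]]
  unfolding derham_def[abs_def] .

lemma additive_koszul: "additive_map (koszul n)"
  using additive_map_sum_of_maps[OF additive_map_comp[OF additive_super_mult_right additive_partial_theta]]
  unfolding koszul_def[abs_def] .

lemma theta_sign_singletons: "theta_sign {i} {j} = (if j < i then - 1 else 1)"
proof -
  have "{(s, t). s \<in> {i} \<and> t \<in> {j} \<and> t < s} = (if j < i then {(i, j)} else {})" by auto
  then show ?thesis unfolding theta_sign_def by (simp only:) simp
qed

lemma theta_sign_insert: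
  "finite S \<Longrightarrow> j \<notin> S \<Longrightarrow> theta_sign {i} (insert j S) = (if j < i then - 1 else 1) * theta_sign {i} S"
  using theta_sign_Un_right[of "{i}" "{j}" S] by (simp add: theta_sign_singletons)

lemma theta_sign_remove:
  "finite S \<Longrightarrow> j \<in> S \<Longrightarrow> theta_sign {i} S = (if j < i then - 1 else 1) * theta_sign {i} (S - {j})"
  using theta_sign_insert[of "S - {j}" j i] by (simp add: insert_absorb)

lemma x_x_commute: "super_x i \<star> (super_x j \<star> f) = super_x j \<star> (super_x i \<star> f)"
  by (rule additive_map_eqI[where f = f])
    (auto simp: x_mult_smono add.left_commute intro!: additive_map_comp[OF additive_super_mult_right] additive_super_mult_right)

lemma x_theta_commute: "super_x i \<star> (super_theta j \<star> f) = super_theta j \<star> (super_x i \<star> f)"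
  by (rule additive_map_eqI[where f = f])
    (auto simp: x_mult_smono theta_mult_smono super_mult_simps intro!: additive_map_comp[OF additive_super_mult_right] additive_super_mult_right)

lemma const_x_commute: "super_const c \<star> (super_x j \<star> f) = super_x j \<star> (super_const c \<star> f)"
  by (rule additive_map_eqI[where f = f])
    (auto simp: x_mult_smono const_mult_smono intro!: additive_map_comp[OF additive_super_mult_right] additive_super_mult_right)

lemma const_theta_commute: "super_const c \<star> (super_theta j \<star> f) = super_theta j \<star> (super_const c \<star> f)"
  by (rule additive_map_eqI[where f = f])
    (auto simp: theta_mult_smono const_mult_smono super_mult_simps mult.left_commute
      intro!: additive_map_comp[OF additive_super_mult_right] additive_super_mult_right)

lemma partial_x_const_mult: "partial_x i (super_const c \<star> f) = super_const c \<star> partial_x i f"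
  by (rule additive_map_eqI[where f = f])
    (auto simp: partial_x_smono const_mult_smono mult.left_commute
      intro!: additive_map_comp[OF additive_partial_x additive_super_mult_right]
       additive_map_comp[OF additive_super_mult_right additive_partial_x])

lemma partial_theta_const_mult: "partial_theta i (super_const c \<star> f) = super_const c \<star> partial_theta i f"
  by (rule additive_map_eqI[where f = f])
    (auto simp: partial_theta_smono const_mult_smono super_mult_simps mult.left_commute
      intro!: additive_map_comp[OF additive_partial_theta additive_super_mult_right]
       additive_map_comp[OF additive_super_mult_right additive_partial_theta])

lemma parity_const_mult: "parity (super_const c \<star> f) = super_const c \<star> parity f"
  by (rule additive_map_eqI[where f = f])
    (auto simp: parity_smono const_mult_smono mult.left_commute
      intro!: additive_map_comp[OF additive_parity additive_super_mult_right]
       additive_map_comp[OF additive_super_mult_right additive_parity])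

text \<open>
  The Weyl relation \<open>\<partial>\<^sub>i x\<^sub>j = \<delta>\<^sub>i\<^sub>j + x\<^sub>j \<partial>\<^sub>i\<close>.
\<close>

lemma partial_x_x: "partial_x i (super_x j \<star> f) = (if i = j then f else 0) + super_x j \<star> partial_x i f"
proof (rule additive_map_eqI[where f = f and F = "\<lambda>f. partial_x i (super_x j \<star> f)" and G = "\<lambda>f. (if i = j then f else 0) + super_x j \<star> partial_x i f"])
  fix a S
  let ?c = "Poly_Mapping.lookup f (a, S)" and ?e = "\<lambda>j. Poly_Mapping.single j (1 :: nat)"
  have *: "?e j + a - ?e i = ?e j + (a - ?e i)" if "Poly_Mapping.lookup a i > 0"
    by (rule poly_mapping_eqI) (use that in \<open>auto simp: lookup_add lookup_minus lookup_single when_def\<close>)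
  show "partial_x i (super_x j \<star> smono a S ?c) = (if i = j then smono a S ?c else 0) + super_x j \<star> partial_x i (smono a S ?c)"
  proof (cases "Poly_Mapping.lookup a i = 0")
    case True
    then show ?thesis
      by (auto simp: x_mult_smono partial_x_smono lookup_add lookup_single when_def super_mult_simps)
  next
    case False
    then show ?thesis
      using exponent_split[of a i] *
      by (auto simp: x_mult_smono partial_x_smono lookup_add lookup_single when_def algebra_simps single_add[symmetric])
  qed
qed (auto intro!: additive_map_comp[OF additive_partial_x additive_super_mult_right] additive_map_plus
       additive_map_comp[OF additive_super_mult_right additive_partial_x], auto simp: additive_map_def)

lemma partial_x_theta: "partial_x i (super_theta j \<star> f) = super_theta j \<star> partial_x i f"
  by (rule additive_map_eqI[where f = f])
    (auto simp: partial_x_smono theta_mult_smono additive_map_zero[OF additive_partial_x] algebra_simps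
      intro!: additive_map_comp[OF additive_partial_x additive_super_mult_right]
       additive_map_comp[OF additive_super_mult_right additive_partial_x])

lemma partial_theta_x: "partial_theta i (super_x j \<star> f) = super_x j \<star> partial_theta i f"
  by (rule additive_map_eqI[where f = f])
    (auto simp: partial_theta_smono x_mult_smono super_mult_simps
      intro!: additive_map_comp[OF additive_partial_theta additive_super_mult_right]
       additive_map_comp[OF additive_super_mult_right additive_partial_theta])

lemma parity_x: "parity (super_x j \<star> f) = super_x j \<star> parity f"
  by (rule additive_map_eqI[where f = f])
    (auto simp: parity_smono x_mult_smono
      intro!: additive_map_comp[OF additive_parity additive_super_mult_right]
       additive_map_comp[OF additive_super_mult_right additive_parity])

context
  fixes f assumes fin: "finitary f"
begin

lemma finitary_keys: "(a, S) \<in> Poly_Mapping.keys f \<Longrightarrow> finite S"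
  using fin by (auto simp: finitary_def)

lemma theta_theta_anticommute: "super_theta i \<star> (super_theta j \<star> f) = - (super_theta j \<star> (super_theta i \<star> f))"
  by (rule additive_map_eqI[where f = f])
    (auto simp: theta_mult_smono super_mult_simps theta_sign_insert finitary_keys insert_commute single_uminus mult.left_commute
      intro!: additive_map_uminus additive_map_comp[OF additive_super_mult_right] additive_super_mult_right)

text \<open>
  The Clifford relation \<open>\<partial>\<^sub>i \<theta>\<^sub>j = \<delta>\<^sub>i\<^sub>j - \<theta>\<^sub>j \<partial>\<^sub>i\<close>.  For \<open>i \<noteq> j\<close> the minus sign arises because
  exactly one of \<open>i < j\<close> and \<open>j < i\<close> holds: either removing \<open>i\<close> or inserting \<open>j\<close> passes the other
  index, but not both.
\<close>

lemma partial_theta_theta: "partial_theta i (super_theta j \<star> f) = (if i = j then f else 0) - super_theta j \<star> partial_theta i f"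
proof -
  have "partial_theta i (super_theta j \<star> f) = (if i = j then f else 0) + - (super_theta j \<star> partial_theta i f)"
  proof (rule additive_map_eqI[where f = f and F = "\<lambda>f. partial_theta i (super_theta j \<star> f)" and G = "\<lambda>f. (if i = j then f else 0) + - (super_theta j \<star> partial_theta i f)"])
    fix a S assume "(a, S) \<in> Poly_Mapping.keys f"
    then have fS: "finite S" by (rule finitary_keys)
    have sq: "theta_sign {j} S * (theta_sign {j} S * c) = c" for c
      using theta_sign_square[of "{j}" S] by (simp flip: mult.assoc)
    let ?p = "smono a S (Poly_Mapping.lookup f (a, S))"
    show "partial_theta i (super_theta j \<star> ?p) = (if i = j then ?p else 0) + - (super_theta j \<star> partial_theta i ?p)"
    proof (cases "i = j")
      case True
      have "theta_sign {j} (S - {j}) = theta_sign {j} S" if "j \<in> S"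
        using theta_sign_remove[OF fS that, of j] by simp
      with True fS show ?thesis
        by (auto simp: theta_mult_smono partial_theta_smono super_mult_simps additive_map_zero[OF additive_partial_theta]
            theta_sign_insert insert_absorb sq)
    next
      case False
      have 1: "theta_sign {i} (insert j S) = (if j < i then - 1 else 1) * theta_sign {i} S" if "j \<notin> S"
        using theta_sign_insert[OF fS that] .
      have 2: "theta_sign {j} S = (if i < j then - 1 else 1) * theta_sign {j} (S - {i})" if "i \<in> S"
        using theta_sign_remove[OF fS that] .
      have 3: "insert j S - {i} = insert j (S - {i})" using False by auto
      show ?thesis
        using False
        by (auto simp: theta_mult_smono partial_theta_smono super_mult_simps additive_map_zero[OF additive_partial_theta]
            1 2 3 single_uminus mult.left_commute)
    qed
  qed (simp_all add: additive_map_def super_mult_simps additive_map_add[OF additive_partial_theta])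
  then show ?thesis by simp
qed

lemma parity_theta: "parity (super_theta j \<star> f) = - (super_theta j \<star> parity f)"
  by (rule additive_map_eqI[where f = f])
    (auto simp: parity_smono theta_mult_smono finitary_keys single_uminus additive_map_zero[OF additive_parity] algebra_simps
      intro!: additive_map_uminus additive_map_comp[OF additive_parity additive_super_mult_right]
       additive_map_comp[OF additive_super_mult_right additive_parity])

end

lemma partial_x_const [simp]: "partial_x i (super_const c) = 0"
  by (simp add: super_const_def partial_x_smono)

lemma partial_theta_const [simp]: "partial_theta i (super_const c) = 0"
  by (simp add: super_const_def partial_theta_smono)

lemma parity_const [simp]: "parity (super_const c) = super_const c"
  by (simp add: super_const_def parity_smono)

lemma derham_const [simp]: "derham n (super_const c) = 0"
  by (simp add: derham_def super_mult_simps)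

lemma koszul_const [simp]: "koszul n (super_const c) = 0"
  by (simp add: koszul_def super_mult_simps)

lemma super_mult_sum_right: "f \<star> (\<Sum>i\<in>A. h i) = (\<Sum>i\<in>A. f \<star> h i)"
  by (rule additive_map_sum[OF additive_super_mult_right])

lemma derham_const_mult: "derham n (super_const c \<star> f) = super_const c \<star> derham n f"
  by (simp add: derham_def partial_x_const_mult super_mult_sum_right const_theta_commute)

lemma koszul_const_mult: "koszul n (super_const c \<star> f) = super_const c \<star> koszul n f"
  by (simp add: koszul_def partial_theta_const_mult super_mult_sum_right const_x_commute)

context coefficient_field
begin

lemma C_partial_x: "f \<in> C \<Longrightarrow> partial_x i f \<in> C"
proof (induction rule: C_induct)
  case (single a S c)
  then show ?case
    unfolding partial_x_smono using keys_diff_nat[of a "Poly_Mapping.single i 1"]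
    by (intro C_single Kmult K_of_nat) auto
qed (simp_all add: additive_map_zero additive_map_add additive_partial_x C_zero C_add)

lemma C_partial_theta: "f \<in> C \<Longrightarrow> partial_theta i f \<in> C"
proof (induction rule: C_induct)
  case (single a S c)
  then show ?case
    by (auto simp: partial_theta_smono C_zero intro!: C_single Kmult K_sign)
qed (simp_all add: additive_map_zero additive_map_add additive_partial_theta C_zero C_add)

lemma C_parity: "f \<in> C \<Longrightarrow> parity f \<in> C"
proof (induction rule: C_induct)
  case (single a S c)
  then show ?case
    unfolding parity_smono by (intro C_single Kmult K_power_minus_one) auto
qed (simp_all add: additive_map_zero additive_map_add additive_parity C_zero C_add)

lemma C_derham: "f \<in> C \<Longrightarrow> derham n f \<in> C"
  unfolding derham_def by (intro C_sum C_mult C_theta C_partial_x) auto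

lemma C_koszul: "f \<in> C \<Longrightarrow> koszul n f \<in> C"
  unfolding koszul_def by (intro C_sum C_mult C_x C_partial_theta) auto

text \<open>
  The Weyl and Clifford relations sum up to the commutation rules of the two operators with the
  generators.  Together with linearity and the vanishing on constants, these four rules determine
  \<open>derham\<close> and \<open>koszul\<close>.
\<close>

lemma derham_x:
  assumes "f \<in> C" "j < n"
  shows "derham n (super_x j \<star> f) = super_theta j \<star> f + super_x j \<star> derham n f"
proof -
  have "derham n (super_x j \<star> f) =
      (\<Sum>i<n. (if i = j then super_theta i \<star> f else 0) + super_x j \<star> (super_theta i \<star> partial_x i f))"
    unfolding derham_def by (intro sum.cong refl) (auto simp: partial_x_x super_mult_simps x_theta_commute)
  then show ?thesis
    using assms(2) by (simp add: derham_def sum.distrib super_mult_sum_right)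
qed

lemma derham_theta:
  assumes "f \<in> C"
  shows "derham n (super_theta j \<star> f) = - (super_theta j \<star> derham n f)"
  unfolding derham_def super_mult_sum_right sum_negf[symmetric]
  by (intro sum.cong refl) (simp add: partial_x_theta theta_theta_anticommute[OF C_finitary[OF C_partial_x[OF assms]], of _ j])

lemma koszul_x: "koszul n (super_x j \<star> f) = super_x j \<star> koszul n f"
  unfolding koszul_def super_mult_sum_right
  by (intro sum.cong refl) (simp add: partial_theta_x x_x_commute[of _ j])

lemma koszul_theta:
  assumes "f \<in> C" "j < n"
  shows "koszul n (super_theta j \<star> f) = super_x j \<star> f - super_theta j \<star> koszul n f"
proof -
  have "koszul n (super_theta j \<star> f) =
      (\<Sum>i<n. (if i = j then super_x i \<star> f else 0) - super_theta j \<star> (super_x i \<star> partial_theta i f))"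
    unfolding koszul_def
    by (intro sum.cong refl) (auto simp: partial_theta_theta[OF C_finitary[OF assms(1)]] super_mult_simps x_theta_commute)
  then show ?thesis
    using assms(2) by (simp add: koszul_def sum_subtractf super_mult_sum_right)
qed

lemmas operator_simps =
  derham_x derham_theta koszul_x koszul_theta parity_x parity_theta[OF C_finitary]
  C_derham C_koszul C_parity C_mult C_x C_theta C_const C_add
  additive_map_add[OF additive_derham] additive_map_add[OF additive_koszul] additive_map_add[OF additive_parity]
  additive_map_diff[OF additive_derham] additive_map_diff[OF additive_koszul] additive_map_diff[OF additive_parity]
  additive_map_minus[OF additive_derham] additive_map_minus[OF additive_koszul] additive_map_minus[OF additive_parity]
  additive_map_zero[OF additive_derham] additive_map_zero[OF additive_koszul] additive_map_zero[OF additive_parity]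

lemma derham_derham: "f \<in> C \<Longrightarrow> derham n (derham n f) = 0"
  by (induction rule: generator_induct) (simp_all add: operator_simps super_mult_simps)

lemma koszul_koszul: "f \<in> C \<Longrightarrow> koszul n (koszul n f) = 0"
  by (induction rule: generator_induct) (simp_all add: operator_simps super_mult_simps)

text \<open>
  The Leibniz rules hold by induction on the left factor, since the commutation rules with
  generators are their special cases.
\<close>

lemma derham_mult:
  assumes "f \<in> C" "g \<in> C"
  shows "derham n (f \<star> g) = derham n f \<star> g + parity f \<star> derham n g"
  using assms(1)
  by (induction rule: generator_induct) (simp_all add: operator_simps super_mult_simps C_assoc assms derham_const_mult)

lemma koszul_mult:
  assumes "f \<in> C" "g \<in> C"
  shows "koszul n (f \<star> g) = koszul n f \<star> g + parity f \<star> koszul n g"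
  using assms(1)
  by (induction rule: generator_induct) (simp_all add: operator_simps super_mult_simps C_assoc assms koszul_const_mult)

lemma parity_mult:
  assumes "f \<in> C" "g \<in> C"
  shows "parity (f \<star> g) = parity f \<star> parity g"
  using assms(1)
  by (induction rule: generator_induct) (simp_all add: operator_simps super_mult_simps C_assoc assms parity_const_mult)

text \<open>
  The anticommutator of the two operators commutes with a generator up to that generator itself:
  the mixed terms cancel.  Every generator in a monomial thus adds \<open>1\<close> to the eigenvalue.
\<close>

lemma euler_smono:
  assumes "Poly_Mapping.keys a \<subseteq> {..<n}" "S \<subseteq> {..<n}" "c \<in> K"
  shows "derham n (koszul n (smono a S c)) + koszul n (derham n (smono a S c)) =
    smono a S (of_nat (xdeg a + card S) * c)"
  using assms(1,2)
proof (induction rule: smono_induct)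
  case const
  show ?case using derham_const koszul_const by (simp add: operator_simps flip: super_const_def)
next
  case (x j a S)
  then have C: "smono a S c \<in> C" using assms by (intro C_single)
  let ?m = "smono a S c"
  have "derham n (koszul n (super_x j \<star> ?m)) + koszul n (derham n (super_x j \<star> ?m)) =
      super_x j \<star> (?m + (derham n (koszul n ?m) + koszul n (derham n ?m)))"
    using C x.hyps by (simp add: operator_simps super_mult_simps)
  also have "\<dots> = smono (Poly_Mapping.single j 1 + a) S (of_nat (xdeg (Poly_Mapping.single j 1 + a) + card S) * c)"
    unfolding x.IH by (simp add: x_mult_smono xdeg_add algebra_simps flip: single_add)
  finally show ?case by (simp only: x_mult_smono)
next
  case (theta j a S)
  then have C: "smono a S c \<in> C" using assms by (intro C_single)
  have "finite S" using theta.hyps finite_subset by blast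
  have "j \<notin> S" using theta.hyps by blast
  let ?m = "smono a S c"
  have m: "super_theta j \<star> smono a S k = smono a (insert j S) k" for k
    using theta.hyps \<open>j \<notin> S\<close> by (simp add: theta_mult_smono theta_sign_less)
  have "derham n (koszul n (super_theta j \<star> ?m)) + koszul n (derham n (super_theta j \<star> ?m)) =
      super_theta j \<star> (?m + (derham n (koszul n ?m) + koszul n (derham n ?m)))"
    using C theta.hyps by (simp add: operator_simps super_mult_simps)
  also have "\<dots> = smono a (insert j S) (of_nat (xdeg a + card (insert j S)) * c)"
    unfolding theta.IH using \<open>finite S\<close> \<open>j \<notin> S\<close> by (simp add: m algebra_simps flip: single_add)
  finally show ?case by (simp only: m)
qed

end

section \<open>Equivariance of the operators\<close>

lemma x_mult_central: "super_x j \<star> f = f \<star> super_x j"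
proof (rule additive_map_eqI[where f = f, OF additive_super_mult_right additive_super_mult_left])
  fix a S
  show "super_x j \<star> smono a S (Poly_Mapping.lookup f (a, S)) = smono a S (Poly_Mapping.lookup f (a, S)) \<star> super_x j"
    by (simp add: super_x_def smono_mult_smono add.commute)
qed

lemma self_negative_imp_zero: "f = - f \<Longrightarrow> f = (0 :: super)"
proof (rule poly_mapping_eqI)
  fix p assume "f = - f"
  then have "Poly_Mapping.lookup f p = Poly_Mapping.lookup (- f) p"
    by (rule arg_cong[where f = "\<lambda>h. Poly_Mapping.lookup h p"])
  then show "Poly_Mapping.lookup f p = Poly_Mapping.lookup 0 p" by simp
qed

abbreviation super_prod :: "super list \<Rightarrow> super" where
  "super_prod us \<equiv> foldr (\<star>) us (super_const 1)"

lemma super_mult_sum_left: "(\<Sum>i\<in>A. h i) \<star> f = (\<Sum>i\<in>A. h i \<star> f)"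
  by (rule additive_map_sum[OF additive_super_mult_left])

text \<open>
  The substitution of linear forms \<open>y j\<close> for the \<open>x\<^sub>j\<close> and \<open>\<eta> j\<close> for the \<open>\<theta>\<^sub>j\<close>, with one common
  coefficient matrix.
\<close>

locale linear_substitution = coefficient_field +
  fixes \<sigma> :: "complex mat"
  assumes entries: "i < n \<Longrightarrow> j < n \<Longrightarrow> cnj (\<sigma> $$ (i, j)) \<in> K"
begin

abbreviation "y \<equiv> act_x n \<sigma>"
abbreviation "\<eta> \<equiv> act_theta n \<sigma>"

lemma C_y: "j < n \<Longrightarrow> y j \<in> C"
  unfolding act_x_def by (intro C_sum C_mult C_const entries C_x) auto

lemma C_eta: "j < n \<Longrightarrow> \<eta> j \<in> C"
  unfolding act_theta_def by (intro C_sum C_mult C_const entries C_theta) auto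

text \<open>
  Constants and the forms \<open>y j\<close> are central, which lets an image \<open>\<eta> j\<close> or \<open>y j\<close> be moved to the
  front of the ordered product that defines the action on a monomial.
\<close>

definition central :: "super set" where
  "central = {z \<in> C. \<forall>f\<in>C. z \<star> f = f \<star> z}"

lemma central_commute: "z \<in> central \<Longrightarrow> f \<in> C \<Longrightarrow> z \<star> f = f \<star> z"
  by (simp add: central_def)

lemma central_C: "z \<in> central \<Longrightarrow> z \<in> C"
  by (simp add: central_def)

lemma central_left_commute:
  assumes "z \<in> central" "f \<in> C" "g \<in> C"
  shows "f \<star> (z \<star> g) = z \<star> (f \<star> g)"
  using C_assoc[of f z g] C_assoc[of z f g] central_commute[of z f] central_C assms by simp

lemma central_const: "c \<in> K \<Longrightarrow> super_const c \<in> central"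
  by (simp add: central_def C_const super_const_central)

lemma central_x: "j < n \<Longrightarrow> super_x j \<in> central"
  by (simp add: central_def C_x x_mult_central)

lemma central_mult:
  assumes "z \<in> central" "w \<in> central"
  shows "z \<star> w \<in> central"
proof -
  have "z \<star> w \<star> f = f \<star> (z \<star> w)" if "f \<in> C" for f
    unfolding C_assoc[OF central_C[OF assms(1)] central_C[OF assms(2)] that] central_commute[OF assms(2) that]
      central_left_commute[OF assms(1) that central_C[OF assms(2)]] ..
  then show ?thesis
    using C_mult[OF central_C[OF assms(1)] central_C[OF assms(2)]] unfolding central_def by blast
qed

lemma central_sum:
  assumes "\<And>i. i \<in> A \<Longrightarrow> h i \<in> central"
  shows "sum h A \<in> central"
proof -
  have "sum h A \<star> f = f \<star> sum h A" if "f \<in> C" for f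
    unfolding super_mult_sum_left super_mult_sum_right
    by (intro sum.cong refl central_commute assms that)
  moreover have "sum h A \<in> C" by (intro C_sum central_C assms)
  ultimately show ?thesis unfolding central_def by blast
qed

lemma central_y: "j < n \<Longrightarrow> y j \<in> central"
  unfolding act_x_def by (intro central_sum central_mult central_const central_x entries) auto

lemma central_power: "z \<in> central \<Longrightarrow> z [^]\<^bsub>super_ring K n\<^esub> (m :: nat) \<in> central"
  by (induction m) (simp_all add: nat_pow_def super_ring_def central_mult central_const K1)

lemma central_prod: "set us \<subseteq> central \<Longrightarrow> super_prod us \<in> central"
  by (induction us) (auto simp: central_mult central_const K1)

definition xpart :: "nat list \<Rightarrow> (nat \<Rightarrow>\<^sub>0 nat) \<Rightarrow> super" where
  "xpart L a = super_prod (map (\<lambda>j. y j [^]\<^bsub>super_ring K n\<^esub> Poly_Mapping.lookup a j) L)"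

definition tpart :: "nat list \<Rightarrow> super" where
  "tpart L = super_prod (map \<eta> L)"

abbreviation act :: "super \<Rightarrow> super" where
  "act \<equiv> super_act K n \<sigma>"

lemma act_as_termwise:
  "act = termwise (\<lambda>a S c. super_const c \<star> xpart [0..<n] a \<star> tpart (sorted_list_of_set S))"
  by (simp add: fun_eq_iff super_act_def termwise_def xpart_def tpart_def super_ring_def Let_def)

lemma additive_act: "additive_map act"
  unfolding act_as_termwise by (rule additive_map_termwise) (simp_all add: super_const_add super_mult_simps)

lemma act_smono: "act (smono a S c) = super_const c \<star> xpart [0..<n] a \<star> tpart (sorted_list_of_set S)"
  unfolding act_as_termwise by (rule termwise_single) (simp add: super_mult_simps)

lemma central_xpart: "set L \<subseteq> {..<n} \<Longrightarrow> xpart L a \<in> central"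
  unfolding xpart_def by (intro central_prod) (auto intro!: central_power central_y)

lemma C_tpart: "set L \<subseteq> {..<n} \<Longrightarrow> tpart L \<in> C"
  unfolding tpart_def by (induction L) (auto simp: C_const K1 C_mult C_eta)

lemma C_act: "f \<in> C \<Longrightarrow> act f \<in> C"
proof (induction rule: C_induct)
  case (single a S c)
  then have "finite S" using finite_subset by blast
  with single show ?case
    unfolding act_smono by (intro C_mult C_const central_C[OF central_xpart] C_tpart) auto
qed (simp_all add: additive_map_zero additive_map_add additive_act C_zero C_add)

lemma xpart_shift:
  assumes "distinct L" "set L \<subseteq> {..<n}" "j < n"
  shows "xpart L (Poly_Mapping.single j 1 + a) = (if j \<in> set L then y j \<star> xpart L a else xpart L a)"
  using assms
proof (induction L)
  case Nil
  then show ?case by (simp add: xpart_def)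
next
  case (Cons h L)
  let ?p = "\<lambda>m. y h [^]\<^bsub>super_ring K n\<^esub> (m :: nat)"
  have p: "?p m \<in> central" for m using Cons.prems by (intro central_power central_y) auto
  have P: "xpart L a \<in> central" using Cons.prems by (intro central_xpart) auto
  have cons: "xpart (h # L) b = ?p (Poly_Mapping.lookup b h) \<star> xpart L b" for b
    by (simp add: xpart_def)
  show ?case
  proof (cases "h = j")
    case True
    let ?m = "Poly_Mapping.lookup a j" and ?e = "Poly_Mapping.single j 1"
    have "?p (Suc ?m) = ?p ?m \<star> y j"
      using True by (simp add: nat_pow_def super_ring_def)
    also have "\<dots> = y j \<star> ?p ?m"
      by (rule central_commute[OF central_y[OF \<open>j < n\<close>] central_C[OF p], symmetric])
    finally have "?p (Suc ?m) = y j \<star> ?p ?m" .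
    moreover have "xpart L (?e + a) = xpart L a"
      using Cons True by simp
    moreover have "Poly_Mapping.lookup (?e + a) h = Suc ?m"
      using True by (simp add: lookup_add)
    moreover have "(y j \<star> ?p ?m) \<star> xpart L a = y j \<star> (?p ?m \<star> xpart L a)"
      by (rule C_assoc[OF C_y[OF \<open>j < n\<close>] central_C[OF p] central_C[OF P]])
    moreover have "xpart (h # L) a = ?p ?m \<star> xpart L a"
      using cons[of a] True by simp
    ultimately have "xpart (h # L) (?e + a) = y j \<star> xpart (h # L) a"
      by (simp only: cons)
    then show ?thesis
      using True by simp
  next
    case False
    then show ?thesis
      using Cons p P C_y central_left_commute[OF central_y[OF \<open>j < n\<close>] central_C[OF p] central_C[OF P]]
      by (auto simp: cons lookup_add lookup_single)
  qed
qed

lemma eta_mult: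
  assumes "f \<in> C" "j < n"
  shows "\<eta> j \<star> f = (\<Sum>k<n. super_const (cnj (\<sigma> $$ (k, j))) \<star> (super_theta k \<star> f))"
  unfolding act_theta_def super_mult_sum_left
  by (intro sum.cong refl C_assoc C_const C_theta entries) (use assms in auto)

lemma eta_anticommute:
  assumes "f \<in> C" "i < n" "j < n"
  shows "\<eta> i \<star> (\<eta> j \<star> f) = - (\<eta> j \<star> (\<eta> i \<star> f))"
proof -
  let ?c = "\<lambda>k i. super_const (cnj (\<sigma> $$ (k, i)))"
  have expand: "\<eta> i \<star> (\<eta> j \<star> f) = (\<Sum>k<n. \<Sum>l<n. ?c k i \<star> (?c l j \<star> (super_theta k \<star> (super_theta l \<star> f))))"
    if "i < n" "j < n" for i j
    using that assms(1)
    by (subst sum.swap) (simp add: eta_mult C_mult C_eta super_mult_sum_right const_theta_commute C_sum C_const C_theta entries)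
  have "\<eta> i \<star> (\<eta> j \<star> f) = (\<Sum>k<n. \<Sum>l<n. - (?c l j \<star> (?c k i \<star> (super_theta l \<star> (super_theta k \<star> f)))))"
    unfolding expand[OF assms(2,3)]
  proof (intro sum.cong refl)
    fix k l assume "k \<in> {..<n}" "l \<in> {..<n}"
    then have kl: "k < n" "l < n" by auto
    have "?c k i \<star> (?c l j \<star> g) = ?c l j \<star> (?c k i \<star> g)" if "g \<in> C" for g
      using central_left_commute[OF central_const, of "cnj (\<sigma> $$ (l, j))" "?c k i" g] that kl assms entries C_const by simp
    then show "?c k i \<star> (?c l j \<star> (super_theta k \<star> (super_theta l \<star> f))) =
        - (?c l j \<star> (?c k i \<star> (super_theta l \<star> (super_theta k \<star> f))))"
      unfolding theta_theta_anticommute[OF C_finitary[OF assms(1)], of k l]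
      using kl assms(1) C_mult C_theta by (simp add: super_mult_simps)
  qed
  also have "\<dots> = - (\<eta> j \<star> (\<eta> i \<star> f))"
    unfolding expand[OF assms(3,2)] sum_negf by (subst sum.swap) simp
  finally show ?thesis .
qed

lemma eta_square: "f \<in> C \<Longrightarrow> j < n \<Longrightarrow> \<eta> j \<star> (\<eta> j \<star> f) = 0"
  using eta_anticommute self_negative_imp_zero by blast

text \<open>
  The forms \<open>\<eta> j\<close> anticommute like the \<open>\<theta>\<^sub>j\<close>, so sorting a new factor into an ordered product
  costs the same sign as for monomials.
\<close>

lemma eta_mult_tpart:
  assumes "sorted L" "distinct L" "set L \<subseteq> {..<n}" "j < n"
  shows "\<eta> j \<star> tpart L =
     (if j \<in> set L then 0 else super_const (theta_sign {j} (set L)) \<star> tpart (insort j L))"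
  using assms
proof (induction L)
  case Nil
  then show ?case by (simp add: tpart_def)
next
  case (Cons h L)
  have cons: "tpart (h # L) = \<eta> h \<star> tpart L" for h L
    by (simp add: tpart_def)
  have L: "tpart L \<in> C" "tpart (insort j L) \<in> C"
    using Cons.prems by (auto intro!: C_tpart simp: set_insort_key)
  consider "j < h" | "j = h" | "h < j" by linarith
  then show ?case
  proof cases
    case 1
    then have "\<forall>t\<in>set (h # L). j < t" using Cons.prems by auto
    then have "theta_sign {j} (set (h # L)) = 1" "j \<notin> set (h # L)" by (blast intro: theta_sign_less)+
    then show ?thesis using 1 by (simp add: cons)
  next
    case 2
    then show ?thesis using eta_square[of "tpart L" j] L Cons.prems by (simp add: cons)
  next
    case 3
    have sign: "theta_sign {j} (set (h # L)) = - theta_sign {j} (set L)"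
      using 3 Cons.prems theta_sign_insert[of "set L" h j] by simp
    have "\<eta> j \<star> tpart (h # L) = - (\<eta> h \<star> (\<eta> j \<star> tpart L))"
      unfolding cons using L Cons.prems by (intro eta_anticommute) auto
    also have "\<eta> j \<star> tpart L = (if j \<in> set L then 0 else super_const (theta_sign {j} (set L)) \<star> tpart (insort j L))"
      using Cons by simp
    finally show ?thesis
      using 3 sign L Cons.prems central_left_commute[OF central_const[OF K_sign] C_eta L(2), of h "{j}" "set L"]
      by (auto simp: cons super_mult_simps super_const_uminus_mult)
  qed
qed

text \<open>
  Multiplicativity of the action is needed only for a generator on the left, which is what an
  induction over generators consumes.
\<close>

lemma act_x_mult:
  assumes "f \<in> C" "j < n"
  shows "act (super_x j \<star> f) = y j \<star> act f"
proof (rule additive_map_eqI[where f = f, OF additive_map_comp[OF additive_act additive_super_mult_right]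
      additive_map_comp[OF additive_super_mult_right additive_act]])
  fix a S assume "(a, S) \<in> Poly_Mapping.keys f"
  from C_keysD[OF assms(1) this] have *: "finite S" "S \<subseteq> {..<n}" "Poly_Mapping.lookup f (a, S) \<in> K" by auto
  let ?c = "super_const (Poly_Mapping.lookup f (a, S))" and ?T = "tpart (sorted_list_of_set S)"
  have C: "?c \<in> C" "xpart [0..<n] a \<in> C" "?T \<in> C"
    using * by (auto intro!: C_const central_C[OF central_xpart] C_tpart)
  show "act (super_x j \<star> smono a S (Poly_Mapping.lookup f (a, S))) =
      y j \<star> act (smono a S (Poly_Mapping.lookup f (a, S)))"
    using assms(2) C C_y[OF assms(2)] central_left_commute[OF central_y[OF assms(2)], of ?c]
    by (simp only: x_mult_smono act_smono xpart_shift[OF distinct_upt _ assms(2)] set_upt atLeast0LessThan order_refl)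
       (simp add: C_assoc C_mult)
qed

lemma act_theta_mult:
  assumes "f \<in> C" "j < n"
  shows "act (super_theta j \<star> f) = \<eta> j \<star> act f"
proof (rule additive_map_eqI[where f = f, OF additive_map_comp[OF additive_act additive_super_mult_right]
      additive_map_comp[OF additive_super_mult_right additive_act]])
  fix a S assume "(a, S) \<in> Poly_Mapping.keys f"
  from C_keysD[OF assms(1) this] have *: "finite S" "S \<subseteq> {..<n}" "Poly_Mapping.lookup f (a, S) \<in> K" by auto
  let ?k = "Poly_Mapping.lookup f (a, S)" and ?X = "xpart [0..<n] a" and ?s = "super_const (theta_sign {j} S)"
  let ?c = "super_const ?k" and ?T = "tpart (sorted_list_of_set S)" and ?T' = "tpart (insort j (sorted_list_of_set S))"
  have X: "?c \<star> ?X \<in> central" using * by (intro central_mult central_const central_xpart) auto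
  have C: "?c \<in> C" "?X \<in> C" "?T \<in> C" "?T' \<in> C" "?s \<in> C" "\<eta> j \<in> C"
    using * assms(2) by (auto intro!: C_const central_C[OF central_xpart] C_tpart C_eta K_sign simp: set_insort_key)
  have "\<eta> j \<star> act (smono a S ?k) = ?c \<star> ?X \<star> (\<eta> j \<star> ?T)"
    unfolding act_smono by (rule central_left_commute[OF X C(6,3)])
  also have "\<eta> j \<star> ?T = (if j \<in> S then 0 else ?s \<star> ?T')"
    using eta_mult_tpart[of "sorted_list_of_set S" j] * assms(2) by simp
  also have "?c \<star> ?X \<star> (if j \<in> S then 0 else ?s \<star> ?T') = act (super_theta j \<star> smono a S ?k)"
  proof (cases "j \<in> S")
    case True
    then show ?thesis by (simp add: theta_mult_smono additive_map_zero[OF additive_act] super_mult_simps)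
  next
    case False
    have "sorted_list_of_set (insert j S) = insort j (sorted_list_of_set S)"
      using False * by (simp add: sorted_list_of_set.sorted_key_list_of_set_insert)
    moreover have "?c \<star> ?X \<star> (?s \<star> ?T') = ?s \<star> (?c \<star> ?X \<star> ?T')"
      using central_left_commute[OF central_const[OF K_sign] central_C[OF X] C(4)] .
    ultimately show ?thesis
      using False C by (simp add: theta_mult_smono act_smono C_assoc C_mult flip: super_const_mult)
  qed
  finally show "act (super_theta j \<star> smono a S ?k) = \<eta> j \<star> act (smono a S ?k)" ..
qed

lemma act_const: "act (super_const c) = super_const c"
proof -
  have "xpart L 0 = super_const 1" for L
    by (induction L) (auto simp: xpart_def nat_pow_def super_ring_def)
  then show ?thesis
    unfolding super_const_def act_smono by (simp add: tpart_def flip: super_const_def)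
qed

text \<open>
  Here the common matrix matters: the operators exchange the \<open>y j\<close> and \<open>\<eta> j\<close> exactly as they
  exchange the \<open>x\<^sub>j\<close> and \<open>\<theta>\<^sub>j\<close>.
\<close>

lemma derham_y: "j < n \<Longrightarrow> derham n (y j) = \<eta> j"
proof -
  have "derham n (super_x i) = super_theta i" if "i < n" for i
    using derham_x[OF C_const[OF K1] that] by (simp add: super_mult_simps)
  then show "j < n \<Longrightarrow> derham n (y j) = \<eta> j"
    by (simp add: act_x_def act_theta_def additive_map_sum[OF additive_derham] derham_const_mult)
qed

lemma derham_eta: "j < n \<Longrightarrow> derham n (\<eta> j) = 0"
  using derham_y C_y derham_derham by metis

lemma koszul_eta: "j < n \<Longrightarrow> koszul n (\<eta> j) = y j"
proof -
  have "koszul n (super_theta i) = super_x i" if "i < n" for i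
    using koszul_theta[OF C_const[OF K1] that] by (simp add: super_mult_simps)
  then show "j < n \<Longrightarrow> koszul n (\<eta> j) = y j"
    by (simp add: act_x_def act_theta_def additive_map_sum[OF additive_koszul] koszul_const_mult)
qed

lemma koszul_y: "j < n \<Longrightarrow> koszul n (y j) = 0"
  using koszul_eta C_eta koszul_koszul by metis

lemma parity_y: "j < n \<Longrightarrow> parity (y j) = y j"
  using parity_x[of _ "super_const 1"] by (simp add: act_x_def additive_map_sum[OF additive_parity] parity_const_mult)

lemma parity_eta: "j < n \<Longrightarrow> parity (\<eta> j) = - \<eta> j"
  using parity_theta[OF C_finitary[OF C_const[OF K1]]]
  by (simp add: act_theta_def additive_map_sum[OF additive_parity] parity_const_mult super_mult_simps sum_negf)

lemma derham_y_mult: "f \<in> C \<Longrightarrow> j < n \<Longrightarrow> derham n (y j \<star> f) = \<eta> j \<star> f + y j \<star> derham n f"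
  by (simp add: derham_mult C_y derham_y parity_y)

lemma derham_eta_mult: "f \<in> C \<Longrightarrow> j < n \<Longrightarrow> derham n (\<eta> j \<star> f) = - (\<eta> j \<star> derham n f)"
  by (simp add: derham_mult C_eta derham_eta parity_eta super_mult_simps)

lemma koszul_y_mult: "f \<in> C \<Longrightarrow> j < n \<Longrightarrow> koszul n (y j \<star> f) = y j \<star> koszul n f"
  by (simp add: koszul_mult C_y koszul_y parity_y super_mult_simps)

lemma koszul_eta_mult: "f \<in> C \<Longrightarrow> j < n \<Longrightarrow> koszul n (\<eta> j \<star> f) = y j \<star> f - \<eta> j \<star> koszul n f"
  by (simp add: koszul_mult C_eta koszul_eta parity_eta super_mult_simps)

lemmas act_simps = act_x_mult act_theta_mult C_act act_const
  derham_y_mult derham_eta_mult koszul_y_mult koszul_eta_mult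
  additive_map_add[OF additive_act] additive_map_diff[OF additive_act] additive_map_minus[OF additive_act]
  additive_map_zero[OF additive_act]

text \<open>
  Before and after the substitution the operators satisfy the same commutation rules with
  generators.
\<close>

lemma act_derham: "f \<in> C \<Longrightarrow> act (derham n f) = derham n (act f)"
  by (induction rule: generator_induct) (simp_all add: act_simps operator_simps super_mult_simps)

lemma act_koszul: "f \<in> C \<Longrightarrow> act (koszul n f) = koszul n (act f)"
  by (induction rule: generator_induct) (simp_all add: act_simps operator_simps super_mult_simps)

end

section \<open>The Euler characteristic of a contractible complex\<close>

text \<open>
  Linearity over a subfield of a not necessarily commutative ring, relative to a subset, in the
  setting in which \<open>dimension\<close> is defined.
\<close>

definition (in ring) linear_on :: "'a set \<Rightarrow> 'a set \<Rightarrow> ('a \<Rightarrow> 'a) \<Rightarrow> bool" where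
  "linear_on F E T \<longleftrightarrow> T ` E \<subseteq> carrier R \<and> (\<forall>u\<in>E. \<forall>v\<in>E. T (u \<oplus> v) = T u \<oplus> T v) \<and>
     (\<forall>c\<in>F. \<forall>v\<in>E. T (c \<otimes> v) = c \<otimes> T v)"

context ring
begin

lemma subalgebra_props:
  assumes "subalgebra F E R"
  shows "E \<subseteq> carrier R" "\<zero> \<in> E" "\<And>u v. u \<in> E \<Longrightarrow> v \<in> E \<Longrightarrow> u \<oplus> v \<in> E"
    "\<And>c v. c \<in> F \<Longrightarrow> v \<in> E \<Longrightarrow> c \<otimes> v \<in> E" "\<And>v. v \<in> E \<Longrightarrow> \<ominus> v \<in> E"
proof -
  interpret subalgebra F E R by fact
  show "E \<subseteq> carrier R" "\<zero> \<in> E" "\<And>u v. u \<in> E \<Longrightarrow> v \<in> E \<Longrightarrow> u \<oplus> v \<in> E"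
    using subset one_closed m_closed by auto
  show "\<And>c v. c \<in> F \<Longrightarrow> v \<in> E \<Longrightarrow> c \<otimes> v \<in> E" by (rule smult_closed)
  show "\<And>v. v \<in> E \<Longrightarrow> \<ominus> v \<in> E" using m_inv_closed unfolding a_inv_def by simp
qed

lemma subalgebraI:
  assumes F: "subfield F R" and E: "E \<subseteq> carrier R" "\<zero> \<in> E"
    and "\<And>u v. u \<in> E \<Longrightarrow> v \<in> E \<Longrightarrow> u \<oplus> v \<in> E"
    and smult: "\<And>c v. c \<in> F \<Longrightarrow> v \<in> E \<Longrightarrow> c \<otimes> v \<in> E"
  shows "subalgebra F E R"
proof (intro subalgebra.intro subalgebra_axioms.intro add.subgroupI)
  fix v assume v: "v \<in> E"
  have "\<ominus> \<one> \<in> F"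
    using subringE(3,5)[OF subfieldE(1)[OF F]] by simp
  then have "\<ominus> \<one> \<otimes> v \<in> E" using v smult by simp
  then show "\<ominus> v \<in> E"
    using v E(1) by (auto simp: l_minus subset_iff)
qed (use assms in auto)

lemma linear_onD:
  assumes "linear_on F E T"
  shows "u \<in> E \<Longrightarrow> T u \<in> carrier R"
    and "u \<in> E \<Longrightarrow> v \<in> E \<Longrightarrow> T (u \<oplus> v) = T u \<oplus> T v"
    and "c \<in> F \<Longrightarrow> v \<in> E \<Longrightarrow> T (c \<otimes> v) = c \<otimes> T v"
  using assms unfolding linear_on_def by auto

lemma linear_on_subset: "linear_on F E T \<Longrightarrow> U \<subseteq> E \<Longrightarrow> linear_on F U T"
  unfolding linear_on_def by (meson image_mono order_trans subsetD)

lemma linear_on_zero: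
  assumes "linear_on F E T" "subalgebra F E R"
  shows "T \<zero> = \<zero>"
proof -
  have z: "\<zero> \<in> E" using subalgebra_props[OF assms(2)] by simp
  have "T (\<zero> \<oplus> \<zero>) = T \<zero> \<oplus> T \<zero>"
    by (rule linear_onD(2)[OF assms(1) z z])
  moreover have "T \<zero> \<in> carrier R"
    by (rule linear_onD(1)[OF assms(1) z])
  ultimately show ?thesis using add.l_cancel_one[of "T \<zero>" "T \<zero>"] by simp
qed

lemma linear_image_subalgebra:
  assumes "subfield F R" "linear_on F E T" "subalgebra F E R"
  shows "subalgebra F (T ` E) R"
proof (rule subalgebraI[OF assms(1)])
  note T = linear_onD[OF assms(2)] and E = subalgebra_props[OF assms(3)]
  show "T ` E \<subseteq> carrier R" using T by auto
  show "\<zero> \<in> T ` E"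
    using linear_on_zero[OF assms(2,3)] E(2) by (metis imageI)
  show "u \<oplus> v \<in> T ` E" if "u \<in> T ` E" "v \<in> T ` E" for u v
    using that T(2) E(3) by (auto simp flip: T(2))
  show "c \<otimes> v \<in> T ` E" if "c \<in> F" "v \<in> T ` E" for c v
    using that T(3) E(4) by (auto simp flip: T(3))
qed

lemma dimension_linear_image:
  assumes "subfield F R" "dimension m F E" "linear_on F E T" "inj_on T E"
  shows "dimension m F (T ` E)"
  using assms(2,1,3,4)
proof (induction m F E rule: dimension.induct)
  case (zero_dim F)
  have "subalgebra F {\<zero>} R"
    using subfieldE(3)[OF zero_dim.prems(1)] by (intro subalgebraI zero_dim.prems(1)) auto
  then have "T ` {\<zero>} = {\<zero>}"
    using linear_on_zero[OF zero_dim.prems(2)] by simp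
  then show ?case by (simp only:) (rule dimension.zero_dim)
next
  case (Suc_dim v E m F)
  let ?L = "line_extension F v E"
  note F = Suc_dim.prems(1) and T = linear_onD[OF Suc_dim.prems(2)]
  have FR: "F \<subseteq> carrier R" "\<zero> \<in> F" "\<one> \<in> F"
    using subfieldE(3)[OF F] subringE(2,3)[OF subfieldE(1)[OF F]] by auto
  have E: "subalgebra F E R"
    by (rule finite_dimension_imp_subalgebra[OF F finite_dimensionI[OF Suc_dim.hyps(3)]])
  note E_props = subalgebra_props[OF E]
  have Ev: "c \<otimes> v \<oplus> e \<in> ?L" if "c \<in> F" "e \<in> E" for c e
    using that by (auto simp: line_extension_mem_iff)
  have "E \<subseteq> ?L"
  proof
    fix e assume "e \<in> E"
    then show "e \<in> ?L" using Ev[OF FR(2), of e] E_props(1) Suc_dim.hyps(1) by auto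
  qed
  moreover have "v \<in> ?L" using Ev[OF FR(3) E_props(2)] Suc_dim.hyps(1) by simp
  ultimately have sub: "E \<subseteq> ?L" "v \<in> ?L" by auto
  have cv: "c \<otimes> v \<in> ?L" if "c \<in> F" for c
    using Ev[OF that E_props(2)] that FR(1) Suc_dim.hyps(1) by auto
  have "T ` ?L = line_extension F (T v) (T ` E)"
  proof -
    have "T (c \<otimes> v \<oplus> e) = c \<otimes> T v \<oplus> T e" if "c \<in> F" "e \<in> E" for c e
      using T(2)[OF cv[OF that(1)], of e] T(3)[OF that(1) sub(2)] that(2) sub(1) by auto
    then have "T ` {c \<otimes> v \<oplus> e |c e. c \<in> F \<and> e \<in> E} = {c \<otimes> T v \<oplus> e |c e. c \<in> F \<and> e \<in> T ` E}"
      by (auto simp: image_iff) metis+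
    moreover have "line_extension F u Y = {c \<otimes> u \<oplus> e |c e. c \<in> F \<and> e \<in> Y}" for u Y
      by (rule Set.set_eqI) (unfold line_extension_mem_iff, blast)
    ultimately show ?thesis by simp
  qed
  moreover have "T v \<notin> T ` E"
    using Suc_dim.prems(3) Suc_dim.hyps(2) sub unfolding inj_on_def by blast
  moreover have "dimension m F (T ` E)"
    using Suc_dim.IH[OF F linear_on_subset[OF Suc_dim.prems(2) sub(1)] inj_on_subset[OF Suc_dim.prems(3) sub(1)]] .
  ultimately show ?case using T(1)[OF sub(2)] by (simp add: dimension.Suc_dim)
qed

text \<open>
  The homotopy identity splits \<open>V k = D (V (k - 1)) \<oplus> I (V (k + 1))\<close>, and \<open>D\<close> maps
  \<open>I (V (k + 1))\<close> isomorphically onto \<open>D (V k)\<close>, with inverse \<open>I\<close> up to the factor \<open>\<mu>\<close>.  With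
  \<open>b k = dim (I (V (k + 1)))\<close> this gives \<open>dim (V k) = b (k - 1) + b k\<close>, and the alternating sum
  telescopes.
\<close>

lemma contractible_complex_euler_characteristic:
  assumes F: "subfield F R"
    and V: "\<And>k. finite_dimension F (V k)" and top: "V (Suc m) = {\<zero>}"
    and D: "\<And>k. linear_on F (V k) D" "\<And>k. D ` V k \<subseteq> V (Suc k)" "\<And>k v. v \<in> V k \<Longrightarrow> D (D v) = \<zero>"
    and I: "\<And>k. linear_on F (V k) I" "\<And>k. I ` V (Suc k) \<subseteq> V k" "\<And>k v. v \<in> V k \<Longrightarrow> I (I v) = \<zero>"
    and I0: "\<And>v. v \<in> V 0 \<Longrightarrow> I v = \<zero>"
    and \<mu>: "\<mu> \<in> F - {\<zero>}"
    and homotopy: "\<And>k v. v \<in> V k \<Longrightarrow> D (I v) \<oplus> I (D v) = \<mu> \<otimes> v"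
  shows "(\<Sum>k\<le>m. (- 1) ^ k * int (dim F (V k))) = 0"
proof -
  note sub = finite_dimension_imp_subalgebra[OF F V]
  note V_props = subalgebra_props[OF sub]
  note Dl = linear_onD[OF D(1)] and Il = linear_onD[OF I(1)]
  have FR: "F \<subseteq> carrier R" using subfieldE(3)[OF F] .
  define \<nu> where "\<nu> = inv \<mu>"
  have \<nu>: "\<nu> \<in> F" "\<nu> \<otimes> \<mu> = \<one>" "\<nu> \<in> carrier R" "\<mu> \<in> carrier R" "\<mu> \<in> F"
    using subfield_m_inv[OF F \<mu>] FR \<mu> by (auto simp: \<nu>_def)
  have scale: "\<nu> \<otimes> (\<mu> \<otimes> v) = v" if "v \<in> V k" for v k
    using that V_props(1)[of k] \<nu> by (auto simp flip: m_assoc)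
  have DV: "v \<in> V k \<Longrightarrow> D v \<in> V (Suc k)" for v k using D(2) by blast
  have IV: "v \<in> V (Suc k) \<Longrightarrow> I v \<in> V k" for v k using I(2) by blast
  have carr: "v \<in> V k \<Longrightarrow> v \<in> carrier R" for v k using V_props(1) by blast
  define A where "A k = D ` V k" for k
  define B where "B k = I ` V (Suc k)" for k
  have subB: "subalgebra F (B k) R" for k
    unfolding B_def by (rule linear_image_subalgebra[OF F I(1) sub])
  have BV: "B k \<subseteq> V k" for k unfolding B_def by (rule I(2))
  have finB: "finite_dimension F (B k)" for k
    by (rule subalbegra_incl_imp_finite_dimension[OF F V subB BV])
  define b where "b k = dim F (B k)" for k
  have dimB: "dimension (b k) F (B k)" for k
    using finite_dimensionE[OF F finB] unfolding b_def over_def .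
  \<comment> \<open>On \<open>B k\<close> the operator \<open>I\<close> vanishes, and the homotopy identity says that \<open>\<nu> I\<close> is a left inverse of \<open>D\<close>.\<close>
  have IDI: "v = \<nu> \<otimes> I (D v)" if vB: "v \<in> B k" for v k
  proof -
    obtain w where w: "w \<in> V (Suc k)" "v = I w" using vB by (auto simp: B_def)
    have v: "v \<in> V k" using vB BV by blast
    have "I v = \<zero>" using I(3)[OF w(1)] w(2) by simp
    then have "D (I v) = \<zero>" using linear_on_zero[OF D(1) sub] by simp
    then have "I (D v) = \<mu> \<otimes> v"
      using homotopy[OF v] carr[OF IV[OF DV[OF v]]] by simp
    then show ?thesis using scale[OF v] by simp
  qed
  have inj: "inj_on D (B k)" for k
    using IDI by (intro inj_onI) metis
  have AB: "A k = D ` B k" for k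
  proof
    show "D ` B k \<subseteq> A k" using BV unfolding A_def by blast
    show "A k \<subseteq> D ` B k"
    proof
      fix u assume "u \<in> A k"
      then obtain v where v: "v \<in> V k" "u = D v" by (auto simp: A_def)
      let ?w = "\<nu> \<otimes> I (D v)"
      have w: "?w \<in> B k"
        using subalgebra_props(4)[OF subB \<nu>(1)] DV[OF v(1)] unfolding B_def by blast
      have "I (D (D v)) = \<zero>"
        using D(3)[OF v(1)] linear_on_zero[OF I(1) sub] by simp
      then have "D (I (D v)) = \<mu> \<otimes> D v"
        using homotopy[OF DV[OF v(1)]] carr[OF DV[OF IV[OF DV[OF v(1)]]]] by simp
      moreover have "D ?w = \<nu> \<otimes> D (I (D v))"
        using Dl(3)[OF \<nu>(1) IV[OF DV[OF v(1)]]] .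
      ultimately have "D ?w = u"
        using scale[OF DV[OF v(1)]] v(2) by simp
      then show "u \<in> D ` B k" using w by blast
    qed
  qed
  have dimA: "dimension (b k) F (A k)" for k
    unfolding AB by (rule dimension_linear_image[OF F dimB linear_on_subset[OF D(1) BV] inj])
  have "V 0 = B 0"
  proof
    show "V 0 \<subseteq> B 0"
    proof
      fix v assume v: "v \<in> V 0"
      have "D (I v) = \<zero>" using I0[OF v] linear_on_zero[OF D(1) sub] by simp
      then have "v = \<nu> \<otimes> I (D v)"
        using homotopy[OF v] scale[OF v] carr[OF IV[OF DV[OF v]]] by simp
      moreover have "\<nu> \<otimes> I (D v) \<in> B 0"
        using subalgebra_props(4)[OF subB \<nu>(1)] DV[OF v] unfolding B_def by blast
      ultimately show "v \<in> B 0" by simp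
    qed
  qed (rule BV)
  then have dim0: "dim F (V 0) = b 0" by (simp add: b_def)
  have dimSuc: "dim F (V (Suc k)) = b k + b (Suc k)" for k
  proof -
    have subA: "subalgebra F (A k) R"
      unfolding A_def by (rule linear_image_subalgebra[OF F D(1) sub])
    have AV: "A k \<subseteq> V (Suc k)" unfolding A_def by (rule D(2))
    have "V (Suc k) = A k <+>\<^bsub>R\<^esub> B (Suc k)"
    proof
      show "V (Suc k) \<subseteq> A k <+>\<^bsub>R\<^esub> B (Suc k)"
      proof
        fix v assume v: "v \<in> V (Suc k)"
        have "\<nu> \<otimes> D (I v) \<in> A k"
          using subalgebra_props(4)[OF subA \<nu>(1)] IV[OF v] unfolding A_def by blast
        moreover have "\<nu> \<otimes> I (D v) \<in> B (Suc k)"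
          using subalgebra_props(4)[OF subB \<nu>(1)] DV[OF v] unfolding B_def by blast
        moreover have "v = \<nu> \<otimes> D (I v) \<oplus> \<nu> \<otimes> I (D v)"
          using homotopy[OF v] scale[OF v] carr[OF IV[OF DV[OF v]]] carr[OF DV[OF IV[OF v]]] \<nu>(3)
          by (simp flip: r_distr)
        ultimately show "v \<in> A k <+>\<^bsub>R\<^esub> B (Suc k)"
          unfolding set_add_def' by blast
      qed
      show "A k <+>\<^bsub>R\<^esub> B (Suc k) \<subseteq> V (Suc k)"
        using AV BV[of "Suc k"] V_props(3)[of _ "Suc k"] unfolding set_add_def' by blast
    qed
    moreover have "A k \<inter> B (Suc k) = {\<zero>}"
    proof
      show "A k \<inter> B (Suc k) \<subseteq> {\<zero>}"
      proof
        fix u assume u: "u \<in> A k \<inter> B (Suc k)"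
        then have "D u = \<zero>" using D(3) by (auto simp: A_def)
        then have "I (D u) = \<zero>" using linear_on_zero[OF I(1) sub] by simp
        then have "u = \<nu> \<otimes> \<zero>" using IDI[of u "Suc k"] u by simp
        then show "u \<in> {\<zero>}" using \<nu>(3) by simp
      qed
      show "{\<zero>} \<subseteq> A k \<inter> B (Suc k)"
        using subalgebra_props(2)[OF subA] subalgebra_props(2)[OF subB] by blast
    qed
    ultimately have "dimension (b k + b (Suc k)) F (V (Suc k))"
      using dimension_direct_sum_space[OF F dimA dimB] by simp
    then show ?thesis using dimI[OF F] by (simp add: over_def)
  qed
  have "(\<Sum>k\<le>l. (- 1) ^ k * int (dim F (V k))) = (- 1) ^ l * int (b l)" for l
    by (induction l) (simp_all add: dim0 dimSuc algebra_simps)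
  moreover have "b m = 0"
  proof -
    have "B m = {\<zero>}"
      unfolding B_def top using linear_on_zero[OF I(1) sub] by simp
    then show ?thesis using dimI[OF F zero_dim] by (simp add: b_def over_def)
  qed
  ultimately show ?thesis by simp
qed

end

section \<open>The ideal of invariants\<close>

lemma super_ring_simps [simp]:
  "f \<otimes>\<^bsub>super_ring K n\<^esub> g = f \<star> g" "\<one>\<^bsub>super_ring K n\<^esub> = super_const 1"
  "f \<oplus>\<^bsub>super_ring K n\<^esub> g = f + g" "\<zero>\<^bsub>super_ring K n\<^esub> = 0"
  by (simp_all add: super_ring_def)

lemma finite_exponents: "finite {a. Poly_Mapping.keys a \<subseteq> {..<n} \<and> xdeg a = i}"
proof (induction i)
  case 0
  have "{a. Poly_Mapping.keys a \<subseteq> {..<n} \<and> xdeg a = 0} \<subseteq> {0}" by (auto simp: xdeg_eq_0_iff)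
  then show ?case by (rule finite_subset) simp
next
  case (Suc i)
  have "{a. Poly_Mapping.keys a \<subseteq> {..<n} \<and> xdeg a = Suc i} \<subseteq>
      (\<Union>j<n. (\<lambda>b. Poly_Mapping.single j 1 + b) ` {b. Poly_Mapping.keys b \<subseteq> {..<n} \<and> xdeg b = i})"
  proof
    fix a :: "nat \<Rightarrow>\<^sub>0 nat" assume "a \<in> {a. Poly_Mapping.keys a \<subseteq> {..<n} \<and> xdeg a = Suc i}"
    then have a: "Poly_Mapping.keys a \<subseteq> {..<n}" "xdeg a = Suc i" by auto
    then obtain j where j: "j \<in> Poly_Mapping.keys a"
      by (metis keys_eq_empty xdeg_zero all_not_in_conv Zero_not_Suc)
    define b where "b = a - Poly_Mapping.single j 1"
    have split: "a = Poly_Mapping.single j 1 + b"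
      unfolding b_def using j by (intro exponent_split) (auto simp: in_keys_iff)
    then have "xdeg b = i" using a(2) by (simp add: xdeg_add)
    moreover have "Poly_Mapping.keys b \<subseteq> {..<n}"
      using keys_diff_nat a(1) unfolding b_def by blast
    ultimately show "a \<in> (\<Union>j<n. (\<lambda>b. Poly_Mapping.single j 1 + b) ` {b. Poly_Mapping.keys b \<subseteq> {..<n} \<and> xdeg b = i})"
      using split j a(1) by blast
  qed
  then show ?case by (rule finite_subset) (use Suc in auto)
qed

context coefficient_field
begin

lemma ring_super_ring: "ring (super_ring K n)"
proof (rule ringI)
  show "abelian_group (super_ring K n)"
  proof (rule abelian_groupI)
    fix f assume "f \<in> C"
    then show "\<exists>g\<in>C. g \<oplus>\<^bsub>super_ring K n\<^esub> f = \<zero>\<^bsub>super_ring K n\<^esub>"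
      by (intro bexI[of _ "- f"]) (auto simp: C_uminus)
  qed (auto simp: C_add C_zero ac_simps)
  show "Group.monoid (super_ring K n)"
    by (rule monoidI) (auto simp: C_mult C_const K1 C_assoc)
qed (auto simp: super_mult_simps)

abbreviation H :: "nat \<Rightarrow> nat \<Rightarrow> super set" where "H \<equiv> super_component K n"

lemma H_iff: "f \<in> H i k \<longleftrightarrow> f \<in> C \<and> (\<forall>(a, S)\<in>Poly_Mapping.keys f. xdeg a = i \<and> card S = k)"
  by (simp add: super_component_def xdeg_def)

lemma H_C: "f \<in> H i k \<Longrightarrow> f \<in> C"
  by (simp add: H_iff)

lemma H_zero: "0 \<in> H i k"
  by (simp add: H_iff C_zero)

lemma H_add: "f \<in> H i k \<Longrightarrow> g \<in> H i k \<Longrightarrow> f + g \<in> H i k"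
  using Poly_Mapping.keys_add[of f g] by (fastforce simp: H_iff C_add)

lemma H_sum: "(\<And>x. x \<in> A \<Longrightarrow> f x \<in> H i k) \<Longrightarrow> sum f A \<in> H i k"
  by (induction A rule: infinite_finite_induct) (auto simp: H_zero H_add)

lemma H_single:
  "Poly_Mapping.keys a \<subseteq> {..<n} \<Longrightarrow> S \<subseteq> {..<n} \<Longrightarrow> c \<in> K \<Longrightarrow> xdeg a = i \<Longrightarrow> card S = k \<Longrightarrow>
    smono a S c \<in> H i k"
  by (simp add: H_iff C_single)

lemma H_induct [consumes 1, case_names zero add single]:
  assumes "f \<in> H i k" "P 0"
    and "\<And>f g. f \<in> H i k \<Longrightarrow> g \<in> H i k \<Longrightarrow> P f \<Longrightarrow> P g \<Longrightarrow> P (f + g)"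
    and "\<And>a S c. Poly_Mapping.keys a \<subseteq> {..<n} \<Longrightarrow> S \<subseteq> {..<n} \<Longrightarrow> c \<in> K \<Longrightarrow> xdeg a = i \<Longrightarrow>
           card S = k \<Longrightarrow> P (smono a S c)"
  shows "P f"
proof -
  have "f \<in> H i k \<and> P f"
  proof (rule super_induct[where f = f])
    fix a S assume aS: "(a, S) \<in> Poly_Mapping.keys f"
    have "f \<in> C" "xdeg a = i" "card S = k" using assms(1) aS unfolding H_iff by auto
    then show "smono a S (Poly_Mapping.lookup f (a, S)) \<in> H i k \<and> P (smono a S (Poly_Mapping.lookup f (a, S)))"
      using C_keysD[OF _ aS] assms(4) H_single by simp
  qed (use assms(2,3) H_zero H_add in auto)
  then show ?thesis ..
qed

lemma H_const_mult: "c \<in> K \<Longrightarrow> f \<in> H i k \<Longrightarrow> super_const c \<star> f \<in> H i k"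
  by (rotate_tac, induction rule: H_induct)
    (simp_all add: super_mult_simps H_zero H_add const_mult_smono H_single Kmult)

text \<open>
  For \<open>i = 0\<close> the truncated degree \<open>i - 1\<close> is harmless, since the image is zero.
\<close>

lemma H_derham:
  assumes "f \<in> H i k"
  shows "derham n f \<in> H (i - 1) (Suc k)" "i = 0 \<Longrightarrow> derham n f = 0"
proof -
  have "derham n f \<in> H (i - 1) (Suc k) \<and> (i = 0 \<longrightarrow> derham n f = 0)"
    using assms
  proof (induction rule: H_induct)
    case (single a S c)
    have fin: "finite S" using single finite_subset by blast
    have "super_theta l \<star> partial_x l (smono a S c) \<in> H (i - 1) (Suc k)" if "l < n" for l
    proof (cases "Poly_Mapping.lookup a l = 0 \<or> l \<in> S")
      case True
      then show ?thesis by (auto simp: partial_x_smono theta_mult_smono super_mult_simps H_zero)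
    next
      case False
      then have "a = Poly_Mapping.single l 1 + (a - Poly_Mapping.single l 1)"
        by (intro exponent_split) simp
      then have "xdeg a = Suc (xdeg (a - Poly_Mapping.single l 1))"
        by (metis xdeg_add xdeg_single plus_1_eq_Suc)
      then show ?thesis
        using False single fin that keys_diff_nat[of a "Poly_Mapping.single l 1"]
        by (auto simp: partial_x_smono theta_mult_smono intro!: H_single Kmult K_sign K_of_nat)
    qed
    moreover have "derham n (smono a S c) = 0" if "i = 0"
      using single that by (simp add: xdeg_eq_0_iff derham_def partial_x_smono super_mult_simps)
    ultimately show ?case by (auto simp: derham_def intro!: H_sum)
  qed (auto simp: additive_map_zero additive_map_add additive_derham H_zero H_add)
  then show "derham n f \<in> H (i - 1) (Suc k)" "i = 0 \<Longrightarrow> derham n f = 0" by auto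
qed

lemma H_koszul:
  assumes "f \<in> H i k"
  shows "koszul n f \<in> H (Suc i) (k - 1)" "k = 0 \<Longrightarrow> koszul n f = 0"
proof -
  have "koszul n f \<in> H (Suc i) (k - 1) \<and> (k = 0 \<longrightarrow> koszul n f = 0)"
    using assms
  proof (induction rule: H_induct)
    case (single a S c)
    have fin: "finite S" using single finite_subset by blast
    have "super_x l \<star> partial_theta l (smono a S c) \<in> H (Suc i) (k - 1)" if "l < n" for l
      using single fin that Poly_Mapping.keys_add[of "Poly_Mapping.single l 1" a]
      by (auto simp: partial_theta_smono x_mult_smono super_mult_simps H_zero xdeg_add
          split: if_splits intro!: H_single Kmult K_sign)
    moreover have "koszul n (smono a S c) = 0" if "k = 0"
      using single that fin by (simp add: koszul_def partial_theta_smono super_mult_simps)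
    ultimately show ?case by (auto simp: koszul_def intro!: H_sum)
  qed (auto simp: additive_map_zero additive_map_add additive_koszul H_zero H_add)
  then show "koszul n f \<in> H (Suc i) (k - 1)" "k = 0 \<Longrightarrow> koszul n f = 0" by auto
qed

lemma H_parity: "f \<in> H i k \<Longrightarrow> parity f = super_const ((- 1) ^ k) \<star> f"
  by (induction rule: H_induct)
    (simp_all add: super_mult_simps parity_smono const_mult_smono additive_map_zero additive_map_add additive_parity)

lemma euler:
  "f \<in> H i k \<Longrightarrow> derham n (koszul n f) + koszul n (derham n f) = super_const (of_nat (i + k)) \<star> f"
proof (induction rule: H_induct)
  case (single a S c)
  then show ?case using euler_smono[of a S c] by (simp add: const_mult_smono)
qed (simp_all add: super_mult_simps additive_map_zero additive_map_add additive_koszul additive_derham algebra_simps)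

end

text \<open>
  The action substitutes with the conjugated entries, so these are the ones that have to be
  coefficients.
\<close>

locale linear_group_action = coefficient_field +
  fixes G :: "complex mat set"
  assumes group_entries: "\<sigma> \<in> G \<Longrightarrow> i < n \<Longrightarrow> j < n \<Longrightarrow> cnj (\<sigma> $$ (i, j)) \<in> K"
begin

lemma linear_substitution: "\<sigma> \<in> G \<Longrightarrow> linear_substitution K n \<sigma>"
  by unfold_locales (rule group_entries)

definition invariants :: "super set" where
  "invariants = {f. \<exists>i k. i + k > 0 \<and> f \<in> H i k \<and> (\<forall>\<sigma>\<in>G. super_act K n \<sigma> f = f)}"

abbreviation J :: "super set" where "J \<equiv> invariant_ideal K n G"

lemma J_eq: "J = genideal (super_ring K n) invariants"
  by (simp add: invariant_ideal_def invariants_def)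

lemma invariants_C: "invariants \<subseteq> C"
  by (auto simp: invariants_def H_C)

sublocale R: ring "super_ring K n"
  by (rule ring_super_ring)

lemma super_idealI:
  assumes "I \<subseteq> C" "0 \<in> I" "\<And>f g. f \<in> I \<Longrightarrow> g \<in> I \<Longrightarrow> f + g \<in> I"
    and "\<And>f g. f \<in> C \<Longrightarrow> g \<in> I \<Longrightarrow> f \<star> g \<in> I" "\<And>f g. f \<in> C \<Longrightarrow> g \<in> I \<Longrightarrow> g \<star> f \<in> I"
  shows "ideal I (super_ring K n)"
proof (rule idealI[OF ring_super_ring])
  show "subgroup I (add_monoid (super_ring K n))"
  proof (rule R.add.subgroupI)
    fix f assume f: "f \<in> I"
    then have "super_const (- 1) \<star> f \<in> I"
      using assms(4) C_const Kminus K1 by blast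
    then have "- f \<in> I" by (simp add: super_const_uminus_mult)
    moreover have "\<ominus>\<^bsub>super_ring K n\<^esub> f = - f"
      using f assms(1) C_uminus by (intro R.minus_equality) auto
    ultimately show "\<ominus>\<^bsub>super_ring K n\<^esub> f \<in> I" by simp
  qed (use assms in auto)
qed (use assms in auto)

lemma ideal_J: "ideal J (super_ring K n)"
  unfolding J_eq by (rule R.genideal_ideal[OF invariants_C])

sublocale J: ideal J "super_ring K n"
  by (rule ideal_J)

lemma J_C: "f \<in> J \<Longrightarrow> f \<in> C"
  using J.a_subset by blast

lemma J_zero: "0 \<in> J" using J.zero_closed by simp
lemma J_add: "f \<in> J \<Longrightarrow> g \<in> J \<Longrightarrow> f + g \<in> J" using J.a_closed by simp
lemma J_left: "f \<in> C \<Longrightarrow> g \<in> J \<Longrightarrow> f \<star> g \<in> J" using J.I_l_closed by simp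
lemma J_right: "f \<in> C \<Longrightarrow> g \<in> J \<Longrightarrow> g \<star> f \<in> J" using J.I_r_closed by simp
lemma J_invariants: "f \<in> invariants \<Longrightarrow> f \<in> J" using R.genideal_self[OF invariants_C] by (auto simp: J_eq)

lemma invariants_derham: "f \<in> invariants \<Longrightarrow> derham n f \<in> J"
proof -
  assume "f \<in> invariants"
  then obtain i k where f: "i + k > 0" "f \<in> H i k" "\<And>\<sigma>. \<sigma> \<in> G \<Longrightarrow> super_act K n \<sigma> f = f"
    by (auto simp: invariants_def)
  show ?thesis
  proof (cases "i = 0")
    case True
    then show ?thesis using H_derham(2)[OF f(2)] J_zero by simp
  next
    case False
    have "super_act K n \<sigma> (derham n f) = derham n f" if "\<sigma> \<in> G" for \<sigma>
      using linear_substitution.act_derham[OF linear_substitution[OF that] H_C[OF f(2)]] f(3)[OF that] by simp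
    then show ?thesis
      using H_derham(1)[OF f(2)] by (intro J_invariants) (force simp: invariants_def)
  qed
qed

lemma invariants_koszul: "f \<in> invariants \<Longrightarrow> koszul n f \<in> J"
proof -
  assume "f \<in> invariants"
  then obtain i k where f: "i + k > 0" "f \<in> H i k" "\<And>\<sigma>. \<sigma> \<in> G \<Longrightarrow> super_act K n \<sigma> f = f"
    by (auto simp: invariants_def)
  have "super_act K n \<sigma> (koszul n f) = koszul n f" if "\<sigma> \<in> G" for \<sigma>
    using linear_substitution.act_koszul[OF linear_substitution[OF that] H_C[OF f(2)]] f(3)[OF that] by simp
  then show ?thesis
    using H_koszul(1)[OF f(2)] by (intro J_invariants) (force simp: invariants_def)
qed

lemma invariants_parity: "f \<in> invariants \<Longrightarrow> parity f \<in> J"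
  using J_left[OF C_const[OF K_power_minus_one] J_invariants[of f]] by (auto simp: invariants_def H_parity)

text \<open>
  It suffices that the elements of the ideal whose images stay in it again form an ideal.  By the
  graded Leibniz rule a product \<open>g \<star> f\<close> with \<open>g\<close> in the ideal has the term
  \<open>parity g \<star> derham n f\<close>, so stability under \<open>parity\<close> has to be carried along.
\<close>

lemma J_stable:
  assumes "f \<in> J"
  shows "derham n f \<in> J" "koszul n f \<in> J"
proof -
  let ?I = "{f \<in> J. parity f \<in> J \<and> derham n f \<in> J \<and> koszul n f \<in> J}"
  have "ideal ?I (super_ring K n)"
  proof (rule super_idealI)
    show "?I \<subseteq> C" using J_C by blast
    show "0 \<in> ?I"
      by (simp add: J_zero additive_map_zero additive_parity additive_derham additive_koszul)
    show "f + g \<in> ?I" if "f \<in> ?I" "g \<in> ?I" for f g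
      using that by (simp add: J_add additive_map_add additive_parity additive_derham additive_koszul)
    show "f \<star> g \<in> ?I" if "f \<in> C" "g \<in> ?I" for f g
      using that by (simp add: J_C parity_mult derham_mult koszul_mult J_add J_left C_parity C_derham C_koszul)
    show "g \<star> f \<in> ?I" if "f \<in> C" "g \<in> ?I" for f g
      using that by (simp add: J_C parity_mult derham_mult koszul_mult J_add J_right C_parity C_derham C_koszul)
  qed
  moreover have "invariants \<subseteq> ?I"
    using J_invariants invariants_parity invariants_derham invariants_koszul by blast
  ultimately have "genideal (super_ring K n) invariants \<subseteq> ?I"
    by (rule R.genideal_minimal)
  then show "derham n f \<in> J" "koszul n f \<in> J" using assms unfolding J_eq by blast+
qed

text \<open>
  Taking the constant term is multiplicative, because a product of two monomials is a constant only
  if both are.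
\<close>

lemma lookup_mult_one:
  "Poly_Mapping.lookup (f \<star> g) (0, {}) = Poly_Mapping.lookup f (0, {}) * Poly_Mapping.lookup g (0, {})"
proof (rule super_induct[where f = f])
  fix a S
  let ?c = "Poly_Mapping.lookup f (a, S)"
  have zero: "a + b = 0 \<longleftrightarrow> a = 0 \<and> b = 0" for a b :: "nat \<Rightarrow>\<^sub>0 nat"
    using xdeg_add[of a b] by (simp flip: xdeg_eq_0_iff)
  show "Poly_Mapping.lookup (smono a S ?c \<star> g) (0, {}) = Poly_Mapping.lookup (smono a S ?c) (0, {}) * Poly_Mapping.lookup g (0, {})"
    by (rule super_induct[where f = g])
      (auto simp: super_mult_simps lookup_add distrib_left smono_mult_smono lookup_single when_def zero)
qed (auto simp: super_mult_simps lookup_add distrib_right)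

text \<open>
  A bihomogeneous element of positive total degree has no constant term.
\<close>

lemma J_proper: "super_const c \<in> J \<Longrightarrow> c = 0"
proof -
  let ?I = "{f \<in> C. Poly_Mapping.lookup f (0, {}) = 0}"
  have "ideal ?I (super_ring K n)"
    by (rule super_idealI) (auto simp: C_zero C_add C_mult lookup_add lookup_mult_one)
  moreover have "invariants \<subseteq> ?I"
  proof
    fix f assume "f \<in> invariants"
    then obtain i k where f: "i + k > 0" "f \<in> H i k" by (auto simp: invariants_def)
    then have "(0, {}) \<notin> Poly_Mapping.keys f" by (auto simp: H_iff)
    then show "f \<in> ?I" using H_C[OF f(2)] by (simp add: in_keys_iff)
  qed
  ultimately have "genideal (super_ring K n) invariants \<subseteq> ?I"
    by (rule R.genideal_minimal)
  then show "super_const c \<in> J \<Longrightarrow> c = 0"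
    unfolding J_eq by (auto simp: super_const_def)
qed

end

section \<open>Strands of the super coinvariant algebra\<close>

context linear_group_action
begin

abbreviation "Q \<equiv> SR K n G"
abbreviation "cls \<equiv> SR_class K n G"

sublocale Q: ring "SR K n G"
  unfolding SR_def by (rule J.quotient_is_ring)

lemma class_hom: "ring_hom_ring (super_ring K n) Q cls"
proof -
  have "cls = (+>\<^bsub>super_ring K n\<^esub>) J" by (simp add: fun_eq_iff SR_class_def)
  then show ?thesis unfolding SR_def using J.rcos_ring_hom_ring by simp
qed

sublocale cls: ring_hom_ring "super_ring K n" "SR K n G" "SR_class K n G"
  by (rule class_hom)

lemma class_add: "f \<in> C \<Longrightarrow> g \<in> C \<Longrightarrow> cls (f + g) = cls f \<oplus>\<^bsub>Q\<^esub> cls g"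
  using cls.hom_add[of f g] by simp

lemma class_mult: "f \<in> C \<Longrightarrow> g \<in> C \<Longrightarrow> cls (f \<star> g) = cls f \<otimes>\<^bsub>Q\<^esub> cls g"
  using cls.hom_mult[of f g] by simp

lemma class_zero: "cls 0 = \<zero>\<^bsub>Q\<^esub>"
  using cls.hom_zero by simp

lemma class_J: "f \<in> J \<Longrightarrow> cls f = \<zero>\<^bsub>Q\<^esub>"
  unfolding class_zero[symmetric] SR_class_def using J.a_rcos_const J_zero by simp

lemma class_eqD:
  assumes "f \<in> C" "g \<in> C" "cls f = cls g"
  shows "f - g \<in> J"
proof -
  have "f \<in> J +>\<^bsub>super_ring K n\<^esub> g"
    using J.a_rcos_self[of f] assms by (simp add: SR_class_def)
  then obtain j where "j \<in> J" "f = j + g" by (auto simp: a_r_coset_def')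
  then show ?thesis by simp
qed

lemma class_one_neq_zero: "\<one>\<^bsub>Q\<^esub> \<noteq> \<zero>\<^bsub>Q\<^esub>"
proof
  assume "\<one>\<^bsub>Q\<^esub> = \<zero>\<^bsub>Q\<^esub>"
  then have "cls (super_const 1) = cls 0"
    using cls.hom_one class_zero by simp
  then have "super_const 1 - 0 \<in> J"
    by (intro class_eqD C_const K1 C_zero)
  then show False using J_proper[of 1] by simp
qed

definition scalars :: "super set set" where "scalars = (cls \<circ> super_const) ` K"

lemma subfield_scalars: "subfield scalars Q"
proof -
  let ?K = "ring_of_type_algebra\<lparr>carrier := K\<rparr> :: complex ring"
  interpret complex: ring "ring_of_type_algebra :: complex ring" ..
  interpret K: field ?K by (rule complex.subfield_iff(2)[OF K_subfield])
  have "super_const \<in> Ring.ring_hom ?K (super_ring K n)"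
    by (rule ring_hom_memI) (simp_all add: C_const super_const_mult super_const_add ring_of_type_algebra_def)
  then have "cls \<circ> super_const \<in> Ring.ring_hom ?K Q"
    using cls.homh by (rule ring_hom_trans)
  then interpret ring_hom_ring ?K Q "cls \<circ> super_const"
    by (intro ring_hom_ringI2 K.ring_axioms Q.ring_axioms)
  show ?thesis
    using img_is_subfield(2)[OF K.carrier_is_subfield class_one_neq_zero] by (simp add: scalars_def)
qed

text \<open>
  The map on classes induced by \<open>T\<close>, computed on an arbitrary representative.
\<close>

definition induced :: "(super \<Rightarrow> super) \<Rightarrow> super set \<Rightarrow> super set" where
  "induced T u = cls (T (SOME f. f \<in> C \<and> cls f = u))"

definition descends :: "(super \<Rightarrow> super) \<Rightarrow> bool" where
  "descends T \<longleftrightarrow> additive_map T \<and> (\<forall>c. \<forall>f\<in>C. T (super_const c \<star> f) = super_const c \<star> T f) \<and> T ` C \<subseteq> C \<and> T ` J \<subseteq> J"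

lemma descendsD:
  assumes "descends T"
  shows "additive_map T" "f \<in> C \<Longrightarrow> T (super_const c \<star> f) = super_const c \<star> T f"
    "f \<in> C \<Longrightarrow> T f \<in> C" "f \<in> J \<Longrightarrow> T f \<in> J"
  using assms unfolding descends_def by blast+

lemma induced_class:
  assumes "descends T" "f \<in> C"
  shows "induced T (cls f) = cls (T f)"
proof -
  let ?g = "SOME g. g \<in> C \<and> cls g = cls f"
  have g: "?g \<in> C \<and> cls ?g = cls f" by (rule someI[of _ f]) (use assms in auto)
  then have "f - ?g \<in> J" using assms(2) by (intro class_eqD) auto
  then have "T (f - ?g) \<in> J" by (rule descendsD(4)[OF assms(1)])
  then have "T f - T ?g \<in> J"
    unfolding additive_map_diff[OF descendsD(1)[OF assms(1)]] .
  then have "cls (T f - T ?g) = \<zero>\<^bsub>Q\<^esub>" by (rule class_J)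
  moreover have "T f - T ?g \<in> C" "T ?g \<in> C"
    using \<open>T f - T ?g \<in> J\<close> J_C g descendsD(3)[OF assms(1)] by blast+
  then have "cls (T f) = cls (T f - T ?g) \<oplus>\<^bsub>Q\<^esub> cls (T ?g)"
    using class_add[of "T f - T ?g" "T ?g"] by simp
  ultimately show ?thesis
    using \<open>T ?g \<in> C\<close> cls.hom_closed by (simp add: induced_def)
qed

lemma induced_linear:
  assumes "descends T" "E \<subseteq> C"
  shows "Q.linear_on scalars (cls ` E) (induced T)"
  unfolding Q.linear_on_def
proof (intro conjI ballI subsetI)
  fix u assume "u \<in> induced T ` cls ` E"
  then obtain f where "f \<in> C" "u = induced T (cls f)" using assms(2) by auto
  then show "u \<in> carrier Q"
    using induced_class[OF assms(1)] cls.hom_closed[OF descendsD(3)[OF assms(1)]] by simp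
next
  fix u v assume "u \<in> cls ` E" "v \<in> cls ` E"
  then obtain f g where fg: "f \<in> C" "g \<in> C" "u = cls f" "v = cls g" using assms(2) by auto
  moreover from fg have "T f \<in> C" "T g \<in> C" using descendsD(3)[OF assms(1)] by auto
  moreover have "T (f + g) = T f + T g" using additive_map_add[OF descendsD(1)[OF assms(1)]] by simp
  ultimately show "induced T (u \<oplus>\<^bsub>Q\<^esub> v) = induced T u \<oplus>\<^bsub>Q\<^esub> induced T v"
    using induced_class[OF assms(1)] C_add by (simp flip: class_add)
next
  fix c v assume "c \<in> scalars" "v \<in> cls ` E"
  then obtain k f where kf: "k \<in> K" "f \<in> C" "c = cls (super_const k)" "v = cls f"
    using assms(2) by (auto simp: scalars_def)
  moreover from kf have "T f \<in> C" using descendsD(3)[OF assms(1)] by auto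
  moreover have "T (super_const k \<star> f) = super_const k \<star> T f"
    using descendsD(2)[OF assms(1) kf(2)] .
  ultimately show "induced T (c \<otimes>\<^bsub>Q\<^esub> v) = c \<otimes>\<^bsub>Q\<^esub> induced T v"
    using induced_class[OF assms(1)] C_mult C_const by (simp flip: class_mult)
qed

lemma descends_derham: "descends (derham n)"
  by (auto simp: descends_def additive_derham derham_const_mult C_derham J_stable)

lemma descends_koszul: "descends (koszul n)"
  by (auto simp: descends_def additive_koszul koszul_const_mult C_koszul J_stable)

abbreviation W :: "nat \<Rightarrow> nat \<Rightarrow> super set set" where "W \<equiv> SR_component K n G"

text \<open>
  The classes of the finitely many monomials of \<open>x\<close>-degree \<open>i\<close> span a space that contains the
  component.
\<close>

lemma finite_dimension_component: "Q.finite_dimension scalars (W i k)"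
proof -
  let ?M = "{a. Poly_Mapping.keys a \<subseteq> {..<n} \<and> xdeg a = i} \<times> Pow {..<n}"
  have "finite ?M" by (intro finite_cartesian_product finite_exponents) simp
  from finite_list[OF this] obtain L where L: "set L = ?M" ..
  define Us where "Us = map (\<lambda>(a, S). cls (smono a S 1)) L"
  have mono_carrier: "cls (smono a S 1) \<in> carrier Q" if "(a, S) \<in> ?M" for a S
  proof (rule cls.hom_closed, rule C_single[OF _ _ K1])
    show "Poly_Mapping.keys a \<subseteq> {..<n}" "S \<subseteq> {..<n}" using that by blast+
  qed
  have mono: "cls (smono a S 1) \<in> set Us" if "(a, S) \<in> ?M" for a S
    unfolding Us_def set_map L by (rule image_eqI[OF _ that]) simp
  have Us: "set Us \<subseteq> carrier Q"
  proof
    fix u assume "u \<in> set Us"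
    then obtain a S where "(a, S) \<in> ?M" "u = cls (smono a S 1)"
      unfolding Us_def set_map L by blast
    then show "u \<in> carrier Q" using mono_carrier by simp
  qed
  note span = Q.Span_subgroup_props[OF subfield_scalars Us]
  have "cls f \<in> Q.Span scalars Us" if "f \<in> H i k" for f
    using that
  proof (induction rule: H_induct)
    case zero
    show ?case using span(2) class_zero by simp
  next
    case (add f g)
    then show ?case using span(3) class_add H_C by simp
  next
    case (single a S c)
    then have "smono a S c = super_const c \<star> smono a S 1" by (simp add: const_mult_smono)
    then have "cls (smono a S c) = cls (super_const c) \<otimes>\<^bsub>Q\<^esub> cls (smono a S 1)"
      using single by (simp add: class_mult C_const C_single K1)
    moreover have "cls (smono a S 1) \<in> Q.Span scalars Us"
      using Q.Span_base_incl[OF subfield_scalars Us] mono[of a S] single by auto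
    moreover have "cls (super_const c) \<in> scalars" using single by (simp add: scalars_def)
    ultimately show ?case using Q.Span_smult_closed[OF subfield_scalars Us] by simp
  qed
  then have "W i k \<subseteq> Q.Span scalars Us" by (auto simp: SR_component_def)
  moreover have "subalgebra scalars (W i k) Q"
  proof (rule Q.subalgebraI[OF subfield_scalars])
    show "W i k \<subseteq> carrier Q" using H_C cls.hom_closed by (auto simp: SR_component_def)
    show "\<zero>\<^bsub>Q\<^esub> \<in> W i k" using H_zero class_zero by (auto simp: SR_component_def)
    show "u \<oplus>\<^bsub>Q\<^esub> v \<in> W i k" if "u \<in> W i k" "v \<in> W i k" for u v
      using that H_add H_C by (auto simp: SR_component_def simp flip: class_add)
    show "c \<otimes>\<^bsub>Q\<^esub> v \<in> W i k" if "c \<in> scalars" "v \<in> W i k" for c v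
      using that H_const_mult H_C C_const by (auto simp: SR_component_def scalars_def simp flip: class_mult)
  qed
  ultimately show ?thesis
    using Q.subalbegra_incl_imp_finite_dimension[OF subfield_scalars Q.Span_finite_dimension[OF subfield_scalars Us]]
    by blast
qed

lemma SR_dim_eq: "SR_dim K n G i k = Q.dim scalars (W i k)"
  by (simp add: SR_dim_def scalars_def)

lemma SR_dim_0_0: "SR_dim K n G 0 0 = 1"
proof -
  have "f \<in> super_const ` K" if "f \<in> H 0 0" for f
    using that
  proof (induction rule: H_induct)
    case zero
    show ?case using K0 by (intro image_eqI[of _ _ 0]) simp_all
  next
    case (add f g)
    then show ?case using Kadd by (auto simp flip: super_const_add)
  next
    case (single a S c)
    then have "finite S" using finite_subset by blast
    with single show ?case by (auto simp: xdeg_eq_0_iff super_const_def)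
  qed
  moreover have "super_const c \<in> H 0 0" if "c \<in> K" for c
    using that H_single[of 0 "{}" c] by (simp add: super_const_def)
  ultimately have "H 0 0 = super_const ` K" by blast
  then have "W 0 0 = scalars" by (simp add: SR_component_def scalars_def image_comp)
  then show ?thesis
    using Q.dimI[OF subfield_scalars Q.dimension_one[OF subfield_scalars]] by (simp add: SR_dim_eq over_def)
qed

text \<open>
  The strand is continued by zero beyond \<open>\<theta>\<close>-degree \<open>m\<close>, where the \<open>x\<close>-degree would be negative.
\<close>

lemma total_degree_euler_characteristic:
  assumes "m > 0"
  shows "(\<Sum>k\<le>m. (- 1) ^ k * int (SR_dim K n G (m - k) k)) = 0"
proof -
  define V where "V k = (if k \<le> m then W (m - k) k else {\<zero>\<^bsub>Q\<^esub>})" for k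
  define E where "E k = (if k \<le> m then H (m - k) k else {0})" for k
  have VE: "V k = cls ` E k" for k
    by (simp add: V_def E_def SR_component_def class_zero)
  have EC: "E k \<subseteq> C" for k using H_C C_zero by (auto simp: E_def)
  let ?D = "induced (derham n)" and ?I = "induced (koszul n)"
  note induced_derham = induced_class[OF descends_derham] and induced_koszul = induced_class[OF descends_koszul]
  \<comment> \<open>Both operators preserve the total degree \<open>m\<close>; off the ends of the strand they vanish.\<close>
  have ED: "derham n f \<in> E (Suc k)" if "f \<in> E k" for f k
    using that H_derham[of f "m - k" k] additive_map_zero[OF additive_derham]
    by (auto simp: E_def H_zero split: if_splits)
  have EI: "koszul n f \<in> E k" if "f \<in> E (Suc k)" for f k
    using that H_koszul(1)[of f "m - Suc k" "Suc k"] additive_map_zero[OF additive_koszul]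
    by (auto simp: E_def H_zero Suc_diff_Suc split: if_splits)
  have "(\<Sum>k\<le>m. (- 1) ^ k * int (Q.dim scalars (V k))) = 0"
  proof (rule Q.contractible_complex_euler_characteristic[OF subfield_scalars, where D = ?D and I = ?I])
    show "Q.finite_dimension scalars (V k)" for k
      using finite_dimension_component Q.finite_dimensionI[OF Q.zero_dim] by (simp add: V_def)
    show "V (Suc m) = {\<zero>\<^bsub>Q\<^esub>}" by (simp add: V_def)
    show "Q.linear_on scalars (V k) ?D" "Q.linear_on scalars (V k) ?I" for k
      unfolding VE by (intro induced_linear descends_derham descends_koszul EC)+
    show "?D ` V k \<subseteq> V (Suc k)" "?I ` V (Suc k) \<subseteq> V k" for k
      using ED EI EC[THEN subsetD] by (auto simp: VE induced_derham induced_koszul)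
    show "?D (?D v) = \<zero>\<^bsub>Q\<^esub>" "?I (?I v) = \<zero>\<^bsub>Q\<^esub>" if "v \<in> V k" for v k
      using that EC[THEN subsetD]
      by (auto simp: VE induced_derham induced_koszul C_derham C_koszul derham_derham koszul_koszul class_zero)
    show "?I v = \<zero>\<^bsub>Q\<^esub>" if "v \<in> V 0" for v
      using that H_koszul(2) H_C by (auto simp: VE E_def induced_koszul class_zero)
    show "cls (super_const (of_nat m)) \<in> scalars - {\<zero>\<^bsub>Q\<^esub>}"
    proof -
      have "cls (super_const (of_nat m)) \<noteq> \<zero>\<^bsub>Q\<^esub>"
        using class_eqD[OF C_const[OF K_of_nat] C_zero, of m] J_proper[of "of_nat m"] assms
        by (auto simp: class_zero)
      then show ?thesis using K_of_nat by (simp add: scalars_def)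
    qed
    show "?D (?I v) \<oplus>\<^bsub>Q\<^esub> ?I (?D v) = cls (super_const (of_nat m)) \<otimes>\<^bsub>Q\<^esub> v" if vV: "v \<in> V k" for v k
    proof -
      obtain f where f: "f \<in> E k" "v = cls f" using vV by (auto simp: VE)
      then have fC: "f \<in> C" using EC by blast
      have "derham n (koszul n f) + koszul n (derham n f) = super_const (of_nat m) \<star> f"
      proof (cases "k \<le> m")
        case True
        then show ?thesis using f euler[of f "m - k" k] by (simp add: E_def)
      next
        case False
        then show ?thesis
          using f by (simp add: E_def additive_map_zero additive_koszul additive_derham super_mult_simps)
      qed
      then show ?thesis
        using fC by (simp add: f(2) induced_derham induced_koszul C_derham C_koszul C_const K_of_nat
            flip: class_add class_mult)
    qed
  qed
  then show ?thesis by (simp add: V_def SR_dim_eq)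
qed

end

theorem corollary1p17:
  fixes K :: "complex set" and n :: nat and G :: "complex mat set"
  assumes "conj_closed_subfield K"
    and "pseudo_reflection_group K n G"
  shows "summable (\<lambda>k. (- fps_X) ^ k * Hilb_theta_degree K n G k)
    \<and> specialize_z (Hilb K n G) (- fps_X) = suminf (\<lambda>k. (- fps_X) ^ k * Hilb_theta_degree K n G k)
    \<and> suminf (\<lambda>k. (- fps_X) ^ k * Hilb_theta_degree K n G k) = 1"
proof -
  have K: "subfield K (ring_of_type_algebra :: complex ring)" "\<And>c. c \<in> K \<Longrightarrow> cnj c \<in> K"
    using assms(1) by (auto simp: conj_closed_subfield_def)
  have "G \<subseteq> mats K n"
    using assms(2) by (auto simp: pseudo_reflection_group_def GL_def units_of_def Units_def dest!: subgroup.subset)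
  then interpret linear_group_action K n G
    by (intro linear_group_action.intro coefficient_field.intro linear_group_action_axioms.intro K)
      (auto simp: mats_def)
  let ?a = "\<lambda>k. (- fps_X) ^ k * Hilb_theta_degree K n G k"
  have nth: "fps_nth (?a k) m = (if k \<le> m then (- 1) ^ k * int (SR_dim K n G (m - k) k) else 0)" for k m
  proof -
    have "fps_nth (?a k) m = fps_nth ((- 1) ^ k * (fps_X ^ k * Hilb_theta_degree K n G k)) m"
      by (simp add: power_minus[of fps_X] mult.assoc)
    also have "\<dots> = (- 1) ^ k * fps_nth (fps_X ^ k * Hilb_theta_degree K n G k) m"
      by (cases "even k") simp_all
    finally show ?thesis
      by (simp add: fps_X_power_mult_nth Hilb_theta_degree_def)
  qed
  \<comment> \<open>Only the summands with \<open>k \<le> m\<close> reach the coefficient of \<open>q ^ m\<close>, so the partial sums stabilise there.\<close>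
  have "?a sums 1"
    unfolding sums_def
  proof (rule tendsto_fpsI)
    fix m
    have "fps_nth (\<Sum>k<N. ?a k) m = fps_nth 1 m" if "N > m" for N
    proof -
      have "fps_nth (\<Sum>k<N. ?a k) m = (\<Sum>k\<le>m. (- 1) ^ k * int (SR_dim K n G (m - k) k))"
        unfolding fps_sum_nth nth using that by (intro sum.mono_neutral_cong_right) auto
      then show ?thesis
        using total_degree_euler_characteristic[of m] SR_dim_0_0 by (cases "m = 0") auto
    qed
    then show "eventually (\<lambda>N. fps_nth (\<Sum>k<N. ?a k) m = fps_nth 1 m) sequentially"
      unfolding eventually_sequentially by (intro exI[of _ "Suc m"]) auto
  qed
  moreover have "specialize_z (Hilb K n G) (- fps_X) = suminf ?a"
    by (simp add: specialize_z_def Hilb_def)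
  ultimately show ?thesis
    using sums_summable sums_unique by metis
qed

end
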